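(* Let $(N,\gamma)$ be a weak Riemannian manifold that is normalizable at a point $x\in N$, with associated open neighborhoods $U_x\subseteq T_xN$ of $0$ and $V_x\subseteq N$ of $x$. Let $r(s)\cdot v(s)\in U_x$, $s\in[0,1]$, be a path in $U_x$ such that $v(s)\in S_xN$ and $r(s)\in\mathbb{R}_{\ge 0}$ (that is, the path is expressed in polar coordinates). Define a path $\alpha$ by $\alpha(s):=\exp_x(r(s)v(s))$, $s\in[0,1]$. Then $$L(\alpha)\ \ge\ |r(1)-r(0)|,$$ with equality if and only if $v(s)$ is constant and $r'(s)\ge 0$.
   Context: A Riemannian metric $\gamma$ on a Hilbert or Fréchet manifold $N$ is a smooth $(0,2)$-tensor inducing a bounded, positive-definite scalar product on each tangent space; it is called strong if the tangent spaces are complete with respect to this scalar product, and weak otherwise. Write $\|v\|_\gamma=\sqrt{\gamma(v,v)}$, and let $L(\alpha)=\int_0^1\|\alpha'(s)\|_\gamma\,ds$ be the length of a path. Geodesics are those of the Levi-Civita connection of $\gamma$ (whose existence is understood as part of the existence of the exponential mapping). The exponential mapping $\exp_x$ sends $v\in T_xN$ to $c_v(1)$, where $c_v$ is the geodesic with $c_v(0)=x$, $c_v'(0)=v$; thus $\exp_x(tv)=c_v(t)$. $(N,\gamma)$ is called normalizable at $x$ if there are neighborhoods $U_x\subseteq T_xN$ of $0$ and $V_x\subseteq N$ of $x$, open in the manifold topology of $N$ ($U_x$ is not required to be open in the topology induced by $\gamma$), such that (1) $U_x$ is convex and (2) the exponential mapping $\exp_x$ exists and is a $C^1$-diffeomorphism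 between $U_x$ and $V_x$. The unit sphere is $S_xN=\{v\in T_xN : \|v\|_\gamma=1\}$.
   Formalization: The printed equality case fails if v is constant and r'<0, or if r=0 on an interval. Proved: equality iff v is constant where r>0 and r' has constant sign; the printed form holds if r(0)≤r(1) and {r>0} is dense in [0,1]. Here r and v are C^1. *)

theory Defs
  imports "HOL-Analysis.Analysis"
begin

section \<open>Frechet spaces\<close>

text \<open>
  A Frechet space is a locally convex topological vector space whose topology is induced by a
  complete translation-invariant metric. Every Banach space, in particular every Hilbert space,
  is an instance.
\<close>

class frechet_space = real_vector + complete_space +
  assumes dist_translation: "dist (x + z) (y + z) = dist x y"
    and tendsto_scaleR_Pair:
      "filterlim (\<lambda>p. fst p *\<^sub>R snd p) (nhds (a *\<^sub>R x)) (nhds a \<times>\<^sub>F nhds x)"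
    and locally_convex_raw:
      "open U \<Longrightarrow> 0 \<in> U \<Longrightarrow> \<exists>V. open V \<and> 0 \<in> V \<and> V \<subseteq> U \<and>
         (\<forall>x\<in>V. \<forall>y\<in>V. \<forall>u\<ge>0. \<forall>v\<ge>0. u + v = 1 \<longrightarrow> u *\<^sub>R x + v *\<^sub>R y \<in> V)"

lemma locally_convex:
  fixes U :: "'a::frechet_space set"
  shows "open U \<Longrightarrow> 0 \<in> U \<Longrightarrow> \<exists>V. open V \<and> convex V \<and> 0 \<in> V \<and> V \<subseteq> U"
  using locally_convex_raw[of U] unfolding convex_def by blast

instance banach \<subseteq> frechet_space
proof
  fix x y z :: 'a and a :: real and U :: "'a set"
  show "dist (x + z) (y + z) = dist x y"
    by (simp add: dist_norm)
  have "((\<lambda>p. fst p *\<^sub>R snd p) \<longlongrightarrow> a *\<^sub>R x) (nhds a \<times>\<^sub>F nhds x)"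
    by (intro tendsto_scaleR filterlim_fst filterlim_snd)
  then show "filterlim (\<lambda>p. fst p *\<^sub>R snd p) (nhds (a *\<^sub>R x)) (nhds a \<times>\<^sub>F nhds x)" .
  assume "open U" "0 \<in> U"
  then obtain e where "e > 0" "ball 0 e \<subseteq> U"
    using open_contains_ball by blast
  then show "\<exists>V. open V \<and> 0 \<in> V \<and> V \<subseteq> U \<and>
      (\<forall>x\<in>V. \<forall>y\<in>V. \<forall>u\<ge>0. \<forall>v\<ge>0. u + v = 1 \<longrightarrow> u *\<^sub>R x + v *\<^sub>R y \<in> V)"
    using convex_ball[of "0::'a" e] unfolding convex_def
    by (intro exI[of _ "ball 0 e"]) auto
qed

instance prod :: (frechet_space, frechet_space) frechet_space
proof
  fix x y z :: "'a \<times> 'b" and a :: real and U :: "('a \<times> 'b) set"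
  show "dist (x + z) (y + z) = dist x y"
    by (simp add: dist_prod_def dist_translation)
  obtain x1 x2 where x: "x = (x1, x2)" by (cases x)
  have nx: "nhds x = nhds x1 \<times>\<^sub>F nhds x2"
    by (simp add: x nhds_prod)
  have l1: "filterlim (\<lambda>p. (fst p, fst (snd p))) (nhds a \<times>\<^sub>F nhds x1) (nhds a \<times>\<^sub>F nhds x)"
    unfolding nx
    by (intro filterlim_Pair filterlim_fst filterlim_compose[OF filterlim_fst filterlim_snd])
  have l2: "filterlim (\<lambda>p. (fst p, snd (snd p))) (nhds a \<times>\<^sub>F nhds x2) (nhds a \<times>\<^sub>F nhds x)"
    unfolding nx
    by (intro filterlim_Pair filterlim_fst filterlim_compose[OF filterlim_snd filterlim_snd])
  have "((\<lambda>p. (fst p *\<^sub>R fst (snd p), fst p *\<^sub>R snd (snd p))) \<longlongrightarrow> (a *\<^sub>R x1, a *\<^sub>R x2))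
      (nhds a \<times>\<^sub>F nhds x)"
    using filterlim_compose[OF tendsto_scaleR_Pair l1] filterlim_compose[OF tendsto_scaleR_Pair l2]
    by (intro tendsto_Pair) simp_all
  then show "filterlim (\<lambda>p. fst p *\<^sub>R snd p) (nhds (a *\<^sub>R x)) (nhds a \<times>\<^sub>F nhds x)"
    by (simp add: x scaleR_prod_def)
  assume "open U" "0 \<in> U"
  then obtain A B where AB: "open A" "open B" "0 \<in> A" "0 \<in> B" "A \<times> B \<subseteq> U"
    by (metis open_prod_elim mem_Sigma_iff zero_prod_def)
  obtain A' where A': "open A'" "convex A'" "0 \<in> A'" "A' \<subseteq> A"
    using locally_convex AB by blast
  obtain B' where B': "open B'" "convex B'" "0 \<in> B'" "B' \<subseteq> B"
    using locally_convex AB by blast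
  have "\<forall>x\<in>A' \<times> B'. \<forall>y\<in>A' \<times> B'. \<forall>u\<ge>0. \<forall>v\<ge>0.
      u + v = 1 \<longrightarrow> u *\<^sub>R x + v *\<^sub>R y \<in> A' \<times> B'"
    using convex_Times[OF A'(2) B'(2)] by (simp only: convex_def)
  moreover have "open (A' \<times> B')" "0 \<in> A' \<times> B'" "A' \<times> B' \<subseteq> U"
    using A' B' AB(5) by (auto simp: open_Times zero_prod_def)
  ultimately show "\<exists>V. open V \<and> 0 \<in> V \<and> V \<subseteq> U \<and>
      (\<forall>x\<in>V. \<forall>y\<in>V. \<forall>u\<ge>0. \<forall>v\<ge>0. u + v = 1 \<longrightarrow> u *\<^sub>R x + v *\<^sub>R y \<in> V)"
    by (intro exI[of _ "A' \<times> B'"] conjI)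
qed


section \<open>Differential calculus in Frechet spaces\<close>

definition has_dir_deriv ::
    "('a::frechet_space \<Rightarrow> 'b::frechet_space) \<Rightarrow> 'b \<Rightarrow> 'a \<Rightarrow> 'a \<Rightarrow> bool" where
  "has_dir_deriv f d x h \<longleftrightarrow>
     ((\<lambda>t::real. (1 / t) *\<^sub>R (f (x + t *\<^sub>R h) - f x)) \<longlongrightarrow> d) (at 0)"

definition dir_deriv ::
    "('a::frechet_space \<Rightarrow> 'b::frechet_space) \<Rightarrow> 'a \<Rightarrow> 'a \<Rightarrow> 'b" where
  "dir_deriv f x h = Lim (at 0) (\<lambda>t::real. (1 / t) *\<^sub>R (f (x + t *\<^sub>R h) - f x))"

text \<open>Iterated directional derivatives: for a list of k directions this is the k-th derivative.\<close>

fun dir_derivs ::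
    "('a::frechet_space \<Rightarrow> 'b::frechet_space) \<Rightarrow> 'a list \<Rightarrow> 'a \<Rightarrow> 'b" where
  "dir_derivs f [] = f"
| "dir_derivs f (h # hs) = (\<lambda>x. dir_deriv (dir_derivs f hs) x h)"

text \<open>
  Class \<open>C\<^sup>k\<close> on an open set in the sense of Michal--Bastiani and Hamilton, the usual notion
  between Frechet spaces: for \<open>j \<le> k\<close> the j-th derivative exists and is jointly continuous in the
  base point and the j directions. The directions are the first j entries of a sequence, so that
  the product topology on sequences restricts to the one on j-tuples. Between Banach spaces,
  smoothness in this sense agrees with smoothness in the sense of Frechet derivatives, and the
  \<open>C\<^sup>1\<close> maps in the latter sense are \<open>C\<^sup>1\<close> in this one.
\<close>

definition Ck_on ::
    "nat \<Rightarrow> 'a set \<Rightarrow> ('a::frechet_space \<Rightarrow> 'b::frechet_space) \<Rightarrow> bool" where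
  "Ck_on k U f \<longleftrightarrow> open U \<and>
     (\<forall>hs x h. length hs < k \<and> x \<in> U \<longrightarrow> (\<exists>d. has_dir_deriv (dir_derivs f hs) d x h)) \<and>
     (\<forall>j\<le>k. continuous_on (U \<times> UNIV)
        (\<lambda>(x, h :: nat \<Rightarrow> 'a). dir_derivs f (map h [0..<j]) x))"

definition smooth_on ::
    "'a set \<Rightarrow> ('a::frechet_space \<Rightarrow> 'b::frechet_space) \<Rightarrow> bool" where
  "smooth_on U f \<longleftrightarrow> (\<forall>k. Ck_on k U f)"

text \<open>Derivatives of curves, one-sided at the end points of the parameter interval.\<close>

definition has_curve_deriv ::
    "(real \<Rightarrow> 'a::frechet_space) \<Rightarrow> 'a \<Rightarrow> real \<Rightarrow> real set \<Rightarrow> bool" where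
  "has_curve_deriv f d t I \<longleftrightarrow>
     ((\<lambda>s. (1 / (s - t)) *\<^sub>R (f s - f t)) \<longlongrightarrow> d) (at t within I)"

definition curve_deriv :: "(real \<Rightarrow> 'a::frechet_space) \<Rightarrow> real \<Rightarrow> real set \<Rightarrow> 'a" where
  "curve_deriv f t I = Lim (at t within I) (\<lambda>s. (1 / (s - t)) *\<^sub>R (f s - f t))"

definition C1_curve_on :: "real set \<Rightarrow> (real \<Rightarrow> 'a::frechet_space) \<Rightarrow> bool" where
  "C1_curve_on I f \<longleftrightarrow>
     (\<exists>f'. continuous_on I f' \<and> (\<forall>t\<in>I. has_curve_deriv f (f' t) t I))"


section \<open>Manifolds\<close>

text \<open>
  The points of the manifold are the elements of a Hausdorff space \<^typ>\<open>'n\<close>, whose topology is the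
  manifold topology; the model space is the Frechet space \<^typ>\<open>'e\<close>. A chart is a pair of its domain
  and the chart map.
\<close>

type_synonym ('n, 'e) chart = "'n set \<times> ('n \<Rightarrow> 'e)"

definition chart_inv :: "('n, 'e) chart \<Rightarrow> 'e \<Rightarrow> 'n" where
  "chart_inv c = inv_into (fst c) (snd c)"

definition chart_image :: "('n, 'e) chart \<Rightarrow> 'e set" where
  "chart_image c = snd c ` fst c"

definition is_chart :: "('n::t2_space, 'e::frechet_space) chart \<Rightarrow> bool" where
  "is_chart c \<longleftrightarrow> open (fst c) \<and> open (chart_image c) \<and>
     homeomorphism (fst c) (chart_image c) (snd c) (chart_inv c)"

definition transition :: "('n, 'e) chart \<Rightarrow> ('n, 'e) chart \<Rightarrow> 'e \<Rightarrow> 'e" where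
  "transition c d = snd d \<circ> chart_inv c"

definition smooth_atlas :: "('n::t2_space, 'e::frechet_space) chart set \<Rightarrow> bool" where
  "smooth_atlas A \<longleftrightarrow> (\<forall>c\<in>A. is_chart c) \<and> \<Union> (fst ` A) = UNIV \<and>
     (\<forall>c\<in>A. \<forall>d\<in>A. smooth_on (snd c ` (fst c \<inter> fst d)) (transition c d))"

definition charts_at :: "('n, 'e) chart set \<Rightarrow> 'n \<Rightarrow> ('n, 'e) chart set" where
  "charts_at A x = {c \<in> A. x \<in> fst c}"

text \<open>
  A tangent vector at x is the family of its representatives in the charts around x, related by
  the derivatives of the transition maps, and set to 0 at all other arguments. For each chart c
  around x, evaluation at c is a linear bijection onto the model space, with inverse
  \<open>tangent_of A x c\<close>; it is a homeomorphism for the topology of the tangent space, which does not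
  depend on c.
\<close>

type_synonym ('n, 'e) tangent = "('n, 'e) chart \<Rightarrow> 'e"

definition tangent_space ::
    "('n, 'e::frechet_space) chart set \<Rightarrow> 'n \<Rightarrow> ('n, 'e) tangent set" where
  "tangent_space A x = {v.
     (\<forall>c\<in>charts_at A x. \<forall>d\<in>charts_at A x. v d = dir_deriv (transition c d) (snd c x) (v c)) \<and>
     (\<forall>c. c \<notin> charts_at A x \<longrightarrow> v c = 0)}"

definition tangent_of ::
    "('n, 'e::frechet_space) chart set \<Rightarrow> 'n \<Rightarrow> ('n, 'e) chart \<Rightarrow> 'e \<Rightarrow> ('n, 'e) tangent" where
  "tangent_of A x c h =
     (\<lambda>d. if d \<in> charts_at A x then dir_deriv (transition c d) (snd c x) h else 0)"

definition tangent_zero :: "('n, 'e::frechet_space) tangent" where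
  "tangent_zero = (\<lambda>c. 0)"

definition tangent_add ::
    "('n, 'e::frechet_space) tangent \<Rightarrow> ('n, 'e) tangent \<Rightarrow> ('n, 'e) tangent" where
  "tangent_add u w = (\<lambda>c. u c + w c)"

definition tangent_diff ::
    "('n, 'e::frechet_space) tangent \<Rightarrow> ('n, 'e) tangent \<Rightarrow> ('n, 'e) tangent" where
  "tangent_diff u w = (\<lambda>c. u c - w c)"

definition tangent_scale ::
    "real \<Rightarrow> ('n, 'e::frechet_space) tangent \<Rightarrow> ('n, 'e) tangent" where
  "tangent_scale a u = (\<lambda>c. a *\<^sub>R u c)"

definition velocity ::
    "('n, 'e::frechet_space) chart set \<Rightarrow> real set \<Rightarrow> (real \<Rightarrow> 'n) \<Rightarrow> real \<Rightarrow> ('n, 'e) tangent" where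
  "velocity A I \<alpha> t =
     (\<lambda>c. if c \<in> charts_at A (\<alpha> t) then curve_deriv (snd c \<circ> \<alpha>) t I else 0)"

definition tangent_open ::
    "('n, 'e::frechet_space) chart set \<Rightarrow> 'n \<Rightarrow> ('n, 'e) tangent set \<Rightarrow> bool" where
  "tangent_open A x U \<longleftrightarrow> U \<subseteq> tangent_space A x \<and> (\<forall>c\<in>charts_at A x. open ((\<lambda>v. v c) ` U))"

definition tangent_convex :: "('n, 'e::frechet_space) tangent set \<Rightarrow> bool" where
  "tangent_convex U \<longleftrightarrow> (\<forall>u\<in>U. \<forall>w\<in>U. \<forall>a\<ge>0. \<forall>b\<ge>0. a + b = 1 \<longrightarrow>
     tangent_add (tangent_scale a u) (tangent_scale b w) \<in> U)"


section \<open>Riemannian metrics\<close>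

type_synonym ('n, 'e) metric_tensor = "'n \<Rightarrow> ('n, 'e) tangent \<Rightarrow> ('n, 'e) tangent \<Rightarrow> real"

definition local_metric ::
    "('n, 'e::frechet_space) chart set \<Rightarrow> ('n, 'e) metric_tensor \<Rightarrow> ('n, 'e) chart \<Rightarrow>
     'e \<Rightarrow> 'e \<Rightarrow> 'e \<Rightarrow> real" where
  "local_metric A \<gamma> c y h k =
     \<gamma> (chart_inv c y) (tangent_of A (chart_inv c y) c h) (tangent_of A (chart_inv c y) c k)"

text \<open>
  Smoothness of the tensor is joint smoothness in the base point and both arguments. It includes
  the boundedness of each scalar product, i.e. its continuity on the tangent space.
\<close>

definition riemannian_metric ::
    "('n, 'e::frechet_space) chart set \<Rightarrow> ('n, 'e) metric_tensor \<Rightarrow> bool" where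
  "riemannian_metric A \<gamma> \<longleftrightarrow>
     (\<forall>x. \<forall>u\<in>tangent_space A x. \<forall>w\<in>tangent_space A x.
        \<gamma> x u w = \<gamma> x w u \<and>
        (\<forall>a. \<gamma> x (tangent_scale a u) w = a * \<gamma> x u w) \<and>
        (\<forall>z\<in>tangent_space A x. \<gamma> x (tangent_add u w) z = \<gamma> x u z + \<gamma> x w z)) \<and>
     (\<forall>x. \<forall>u\<in>tangent_space A x. u \<noteq> tangent_zero \<longrightarrow> \<gamma> x u u > 0) \<and>
     (\<forall>c\<in>A. smooth_on (chart_image c \<times> UNIV \<times> UNIV) (\<lambda>(y, h, k). local_metric A \<gamma> c y h k))"

definition gnorm :: "('n, 'e) metric_tensor \<Rightarrow> 'n \<Rightarrow> ('n, 'e) tangent \<Rightarrow> real" where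
  "gnorm \<gamma> x v = sqrt (\<gamma> x v v)"

definition strong_metric ::
    "('n, 'e::frechet_space) chart set \<Rightarrow> ('n, 'e) metric_tensor \<Rightarrow> bool" where
  "strong_metric A \<gamma> \<longleftrightarrow> (\<forall>x. \<forall>u :: nat \<Rightarrow> ('n, 'e) tangent.
     (\<forall>n. u n \<in> tangent_space A x) \<and>
     (\<forall>e>0. \<exists>M. \<forall>m\<ge>M. \<forall>n\<ge>M. gnorm \<gamma> x (tangent_diff (u m) (u n)) < e) \<longrightarrow>
     (\<exists>w\<in>tangent_space A x. (\<lambda>n. gnorm \<gamma> x (tangent_diff (u n) w)) \<longlonglongrightarrow> 0))"

definition weak_riemannian_manifold ::
    "('n::t2_space, 'e::frechet_space) chart set \<Rightarrow> ('n, 'e) metric_tensor \<Rightarrow> bool" where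
  "weak_riemannian_manifold A \<gamma> \<longleftrightarrow>
     smooth_atlas A \<and> riemannian_metric A \<gamma> \<and> \<not> strong_metric A \<gamma>"

definition unit_sphere ::
    "('n, 'e::frechet_space) chart set \<Rightarrow> ('n, 'e) metric_tensor \<Rightarrow> 'n \<Rightarrow> ('n, 'e) tangent set" where
  "unit_sphere A \<gamma> x = {v \<in> tangent_space A x. gnorm \<gamma> x v = 1}"

text \<open>Length of a curve parametrized by the unit interval.\<close>

definition path_length ::
    "('n, 'e::frechet_space) chart set \<Rightarrow> ('n, 'e) metric_tensor \<Rightarrow> (real \<Rightarrow> 'n) \<Rightarrow> real" where
  "path_length A \<gamma> \<alpha> = integral {0..1} (\<lambda>s. gnorm \<gamma> (\<alpha> s) (velocity A {0..1} \<alpha> s))"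


section \<open>Levi-Civita connection, geodesics, exponential mapping\<close>

text \<open>
  A linear connection is given by its Christoffel maps \<open>\<Gamma> c\<close> in the charts c, with the sign
  convention that the covariant derivative of Y along X is \<open>DY(X) + \<Gamma> c y X Y\<close> in the chart c.
  The last clause is the transformation rule making this covariant derivative independent of the
  chart.
\<close>

type_synonym ('n, 'e) christoffel = "('n, 'e) chart \<Rightarrow> 'e \<Rightarrow> 'e \<Rightarrow> 'e \<Rightarrow> 'e"

definition connection ::
    "('n, 'e::frechet_space) chart set \<Rightarrow> ('n, 'e) christoffel \<Rightarrow> bool" where
  "connection A \<Gamma> \<longleftrightarrow>
     (\<forall>c\<in>A. smooth_on (chart_image c \<times> UNIV \<times> UNIV) (\<lambda>(y, h, k). \<Gamma> c y h k) \<and>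
        (\<forall>y\<in>chart_image c. \<forall>h. linear (\<lambda>k. \<Gamma> c y h k) \<and> linear (\<lambda>k. \<Gamma> c y k h))) \<and>
     (\<forall>c\<in>A. \<forall>d\<in>A. \<forall>y\<in>snd c ` (fst c \<inter> fst d). \<forall>h k.
        dir_deriv (transition c d) y (\<Gamma> c y h k) =
        dir_derivs (transition c d) [h, k] y +
        \<Gamma> d (transition c d y) (dir_deriv (transition c d) y h) (dir_deriv (transition c d) y k))"

text \<open>Torsion-free and compatible with the metric.\<close>

definition levi_civita ::
    "('n, 'e::frechet_space) chart set \<Rightarrow> ('n, 'e) metric_tensor \<Rightarrow> ('n, 'e) christoffel \<Rightarrow> bool" where
  "levi_civita A \<gamma> \<Gamma> \<longleftrightarrow> connection A \<Gamma> \<and>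
     (\<forall>c\<in>A. \<forall>y\<in>chart_image c. \<forall>h k. \<Gamma> c y h k = \<Gamma> c y k h) \<and>
     (\<forall>c\<in>A. \<forall>y\<in>chart_image c. \<forall>h k l.
        dir_deriv (\<lambda>z. local_metric A \<gamma> c z k l) y h =
        local_metric A \<gamma> c y (\<Gamma> c y h k) l + local_metric A \<gamma> c y k (\<Gamma> c y h l))"

text \<open>
  The Levi-Civita connection of a weak metric need not exist, but it is unique on the chart images,
  so the existential quantifier below does not involve a choice. In each chart, \<open>u'\<close> is the first
  derivative of the curve and the second derivative is prescribed by the geodesic equation.
\<close>

definition geodesic ::
    "('n::t2_space, 'e::frechet_space) chart set \<Rightarrow> ('n, 'e) metric_tensor \<Rightarrow>
     real set \<Rightarrow> (real \<Rightarrow> 'n) \<Rightarrow> bool" where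
  "geodesic A \<gamma> I \<alpha> \<longleftrightarrow> continuous_on I \<alpha> \<and>
     (\<exists>\<Gamma>. levi_civita A \<gamma> \<Gamma> \<and>
        (\<forall>c\<in>A. \<exists>u'. \<forall>t\<in>I. \<alpha> t \<in> fst c \<longrightarrow>
           has_curve_deriv (snd c \<circ> \<alpha>) (u' t) t I \<and>
           has_curve_deriv u' (- \<Gamma> c (snd c (\<alpha> t)) (u' t) (u' t)) t I))"

definition geodesic_from ::
    "('n::t2_space, 'e::frechet_space) chart set \<Rightarrow> ('n, 'e) metric_tensor \<Rightarrow>
     'n \<Rightarrow> ('n, 'e) tangent \<Rightarrow> (real \<Rightarrow> 'n) \<Rightarrow> bool" where
  "geodesic_from A \<gamma> x v \<alpha> \<longleftrightarrow>
     geodesic A \<gamma> {0..1} \<alpha> \<and> \<alpha> 0 = x \<and> velocity A {0..1} \<alpha> 0 = v"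

text \<open>The geodesic on the unit interval with the given initial data exists and is unique.\<close>

definition riem_exp_exists ::
    "('n::t2_space, 'e::frechet_space) chart set \<Rightarrow> ('n, 'e) metric_tensor \<Rightarrow>
     'n \<Rightarrow> ('n, 'e) tangent \<Rightarrow> bool" where
  "riem_exp_exists A \<gamma> x v \<longleftrightarrow>
     (\<exists>\<alpha>. geodesic_from A \<gamma> x v \<alpha> \<and>
        (\<forall>\<beta>. geodesic_from A \<gamma> x v \<beta> \<longrightarrow> (\<forall>t\<in>{0..1}. \<beta> t = \<alpha> t)))"

definition riem_exp ::
    "('n::t2_space, 'e::frechet_space) chart set \<Rightarrow> ('n, 'e) metric_tensor \<Rightarrow>
     'n \<Rightarrow> ('n, 'e) tangent \<Rightarrow> 'n" where
  "riem_exp A \<gamma> x v = (THE y. \<exists>\<alpha>. geodesic_from A \<gamma> x v \<alpha> \<and> y = \<alpha> 1)"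

text \<open>
  \<open>C\<^sup>1\<close>-diffeomorphism from an open subset U of the tangent space at x onto an open subset V of
  the manifold. The tangent space is identified with the model space by any chart c around x.
\<close>

definition C1_diffeo ::
    "('n::t2_space, 'e::frechet_space) chart set \<Rightarrow> 'n \<Rightarrow>
     ('n, 'e) tangent set \<Rightarrow> 'n set \<Rightarrow> (('n, 'e) tangent \<Rightarrow> 'n) \<Rightarrow> bool" where
  "C1_diffeo A x U V f \<longleftrightarrow> bij_betw f U V \<and>
     (\<forall>c\<in>charts_at A x. \<forall>d\<in>A.
        Ck_on 1 {h \<in> (\<lambda>v. v c) ` U. f (tangent_of A x c h) \<in> fst d}
          (\<lambda>h. snd d (f (tangent_of A x c h))) \<and>
        Ck_on 1 (snd d ` (V \<inter> fst d)) (\<lambda>y. the_inv_into U f (chart_inv d y) c))"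

definition normalizable_on ::
    "('n::t2_space, 'e::frechet_space) chart set \<Rightarrow> ('n, 'e) metric_tensor \<Rightarrow>
     'n \<Rightarrow> ('n, 'e) tangent set \<Rightarrow> 'n set \<Rightarrow> bool" where
  "normalizable_on A \<gamma> x U V \<longleftrightarrow>
     tangent_open A x U \<and> tangent_zero \<in> U \<and> open V \<and> x \<in> V \<and>
     tangent_convex U \<and>
     (\<forall>v\<in>U. riem_exp_exists A \<gamma> x v) \<and> C1_diffeo A x U V (riem_exp A \<gamma> x)"

text \<open>A \<open>C\<^sup>1\<close> path, on the unit interval, in the tangent space at x.\<close>

definition C1_tangent_path ::
    "('n, 'e::frechet_space) chart set \<Rightarrow> 'n \<Rightarrow> (real \<Rightarrow> ('n, 'e) tangent) \<Rightarrow> bool" where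
  "C1_tangent_path A x v \<longleftrightarrow> (\<forall>s\<in>{0..1}. v s \<in> tangent_space A x) \<and>
     (\<forall>c\<in>charts_at A x. C1_curve_on {0..1} (\<lambda>s. v s c))"

end

theory Submission
  imports Defs
begin

text \<open>
  The heart is the Gauss lemma \<open>\<gamma>(d exp \<omega>, d exp z) = \<gamma>(\<omega>, z)\<close> at \<open>\<omega> \<in> U\<close>. For the variation
  \<open>exp(t (\<omega> + \<sigma> z))\<close> of a radial geodesic, the pairing of the velocity with the variation field is
  shown to have constant derivative \<open>\<gamma>(\<omega>, z)\<close> in \<open>t\<close>. The usual exchange of \<open>\<partial>\<^sub>\<sigma>\<close> and \<open>\<partial>\<^sub>t\<close> is not
  available for an exponential mapping of class \<open>C\<^sup>1\<close>; it is replaced by a one-sided estimate, obtained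
  from the constancy of the speed of geodesics, that is applied to \<open>z\<close> and to \<open>- z\<close>.

  In polar coordinates it follows that \<open>\<parallel>\<alpha>'\<parallel>\<^sup>2 = r'\<^sup>2 + r\<^sup>2 \<parallel>d exp v'\<parallel>\<^sup>2\<close> where \<open>r > 0\<close>, hence
  \<open>\<parallel>\<alpha>'\<parallel> \<ge> \<bar>r'\<bar>\<close> on the unit interval by continuity (\<open>r' = 0\<close> at the interior zeros of \<open>r\<close>). Equality
  forces \<open>d exp v' = 0\<close>, and then \<open>v' = 0\<close> because \<open>exp\<close> is a diffeomorphism.
\<close>

section \<open>Calculus in Frechet spaces\<close>

text \<open>The model space is only locally convex, so norm estimates are replaced by a strict form
  of differentiability, \<open>Ck_on_difference_quotient\<close>, in which base point, direction and
  step may all vary. Additivity of derivatives, the chain rule and the difference quotients in the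
  Gauss lemma are drawn from it.

  The equality case needs care at two places. Length ignores the sense of traversal, so a radial
  path running towards \<open>x\<close> also attains equality; both signs of \<open>r'\<close>
  therefore occur. Where \<open>r\<close> vanishes the path does not depend on \<open>v\<close>, so
  \<open>v\<close> may turn while the path rests at \<open>x\<close>; constancy of \<open>v\<close>
  can only be concluded on \<open>r > 0\<close>, and it extends to the whole interval when that set
  is dense.\<close>

lemma tendsto_scaleR_frechet:
  fixes g :: "'i \<Rightarrow> 'a::frechet_space"
  assumes "(f \<longlongrightarrow> a) F" "(g \<longlongrightarrow> x) F"
  shows "((\<lambda>i. f i *\<^sub>R g i) \<longlongrightarrow> a *\<^sub>R x) F"
  using filterlim_compose[OF tendsto_scaleR_Pair filterlim_Pair[OF assms]] by simp

text \<open>Continuity of addition is not among the axioms of \<open>frechet_space\<close>. It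
  follows from translation invariance of the metric by moving one summand at a time.\<close>

lemma tendsto_add_frechet:
  fixes f g :: "'i \<Rightarrow> 'a::frechet_space"
  assumes "(f \<longlongrightarrow> a) F" "(g \<longlongrightarrow> b) F"
  shows "((\<lambda>i. f i + g i) \<longlongrightarrow> a + b) F"
proof (rule tendstoI)
  fix e :: real assume "e > 0"
  have "\<forall>\<^sub>F i in F. dist (f i) a < e / 2" "\<forall>\<^sub>F i in F. dist (g i) b < e / 2"
    using \<open>e > 0\<close> by (auto intro: tendstoD[OF assms(1)] tendstoD[OF assms(2)] simp del: less_divide_eq_numeral1)
  then show "\<forall>\<^sub>F i in F. dist (f i + g i) (a + b) < e"
  proof eventually_elim
    case (elim i)
    have "dist (f i + g i) (a + b) \<le> dist (f i + g i) (a + g i) + dist (a + g i) (a + b)"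
      by (rule dist_triangle)
    also have "dist (f i + g i) (a + g i) = dist (f i) a" by (rule dist_translation)
    also have "dist (a + g i) (a + b) = dist (g i) b"
      using dist_translation[of "g i" a b] by (simp add: add.commute)
    finally show ?case using elim by linarith
  qed
qed

lemma tendsto_diff_frechet:
  fixes f g :: "'i \<Rightarrow> 'a::frechet_space"
  assumes "(f \<longlongrightarrow> a) F" "(g \<longlongrightarrow> b) F"
  shows "((\<lambda>i. f i - g i) \<longlongrightarrow> a - b) F"
  using tendsto_add_frechet[OF assms(1) tendsto_scaleR_frechet[OF tendsto_const assms(2), of "-1"]]
  by simp

lemma locally_convex_at:
  fixes U :: "'a::frechet_space set"
  assumes "open U" "x \<in> U"
  obtains V where "open V" "convex V" "x \<in> V" "V \<subseteq> U"
proof -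
  have trans: "continuous_on UNIV (\<lambda>y :: 'a. y + z)" for z
    unfolding continuous_on_def
    by (intro ballI tendsto_add_frechet tendsto_ident_at tendsto_const)
  have "open ((\<lambda>y. y + x) -` U)"
    using assms(1) by (intro open_vimage trans)
  then obtain W where W: "open W" "convex W" "0 \<in> W" "W \<subseteq> (\<lambda>y. y + x) -` U"
    using locally_convex[of "(\<lambda>y. y + x) -` U"] assms by auto
  have eq: "(\<lambda>y. y - x) -` W = (+) x ` W" by (auto intro!: image_eqI[of _ _ "_ - x"])
  have "open ((\<lambda>y. y - x) -` W)"
    using W(1) trans[of "- x"] by (intro open_vimage) simp_all
  moreover have "convex ((\<lambda>y. y - x) -` W)"
    unfolding eq using W by (simp add: convex_translation)
  moreover have "(\<lambda>y. y - x) -` W \<subseteq> U"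
    using W(4) by fastforce
  ultimately show ?thesis using W(3) that by (metis vimageI diff_self)
qed

lemma has_curve_deriv_subset:
  "has_curve_deriv f d t I \<Longrightarrow> J \<subseteq> I \<Longrightarrow> has_curve_deriv f d t J"
  unfolding has_curve_deriv_def by (rule tendsto_within_subset)

text \<open>Open convex sets replace linear functionals here: no Hahn--Banach theorem is needed.\<close>

lemma mean_value_convex:
  fixes f :: "real \<Rightarrow> 'a::frechet_space"
  assumes "a < b"
    and der: "\<And>t. t \<in> {a..b} \<Longrightarrow> has_curve_deriv f (f' t) t {a..b}"
    and in_C: "\<And>t. t \<in> {a..b} \<Longrightarrow> f' t \<in> C"
    and C: "open C" "convex C"
  shows "(1 / (b - a)) *\<^sub>R (f b - f a) \<in> C"
proof -
  define q where "q l r = (1 / (r - l)) *\<^sub>R (f r - f l)" for l r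
  \<comment> \<open>A quotient over an interval is the convex combination of the quotients over its
    two pieces, weighted by their relative lengths; this is where convexity of \<open>C\<close>
    enters.\<close>
  have comb: "q l r = ((m - l) / (r - l)) *\<^sub>R q l m + ((r - m) / (r - l)) *\<^sub>R q m r"
    if "l < m" "m < r" for l m r
  proof -
    have "((m - l) / (r - l)) *\<^sub>R q l m = (1 / (r - l)) *\<^sub>R (f m - f l)"
      "((r - m) / (r - l)) *\<^sub>R q m r = (1 / (r - l)) *\<^sub>R (f r - f m)"
      using that by (simp_all add: q_def)
    then show ?thesis by (simp add: q_def scaleR_add_right[symmetric])
  qed
  have q_trans: "q l r \<in> C" if "l < m" "m < r" "q l m \<in> C" "q m r \<in> C" for l m r
  proof -
    have "(m - l) / (r - l) + (r - m) / (r - l) = 1"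
      using that by (simp add: add_divide_distrib[symmetric])
    then show ?thesis
      unfolding comb[OF that(1,2)] using that by (intro convexD[OF C(2)]) auto
  qed
  \<comment> \<open>The limit at a point \<open>t\<close> has \<open>t\<close> as first argument;
    symmetry makes it serve intervals that end at \<open>t\<close> as well.\<close>
  have q_sym: "q l r = q r l" for l r
  proof -
    have "1 / (l - r) = - (1 / (r - l))" by (metis minus_diff_eq minus_divide_right)
    then show ?thesis by (simp add: q_def scaleR_diff_right)
  qed
  \<comment> \<open>Bisection passes from short intervals around each point to
    \<open>{a..b}\<close>. The guards make \<open>P\<close> vacuous for degenerate intervals and for
    those leaving \<open>{a..b}\<close>, which the rule \<open>Bolzano\<close> does not
    exclude.\<close>
  define P where "P l r \<longleftrightarrow> (a \<le> l \<longrightarrow> r \<le> b \<longrightarrow> l < r \<longrightarrow> q l r \<in> C)" for l r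
  have "P a b"
    using less_imp_le[OF \<open>a < b\<close>]
  proof (induction rule: Bolzano)
    case (trans l m r)
    then show ?case
      unfolding P_def by (cases "l = m"; cases "m = r") (auto intro: q_trans[of l m r])
  next
    case (local t)
    have "\<forall>\<^sub>F s in at t within {a..b}. q t s \<in> C"
      using der[of t] in_C[of t] local C(1)
      unfolding has_curve_deriv_def q_def tendsto_def by auto
    then obtain d where d: "d > 0" "\<And>s. s \<in> {a..b} \<Longrightarrow> s \<noteq> t \<Longrightarrow> dist s t < d \<Longrightarrow> q t s \<in> C"
      unfolding eventually_at by auto
    have "q l r \<in> C" if "l \<le> t" "t \<le> r" "r - l < d" "a \<le> l" "r \<le> b" "l < r" for l r
    proof -
      have 1: "t < r \<Longrightarrow> q t r \<in> C" using d(2)[of r] that by (auto simp: dist_real_def)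
      have 2: "l < t \<Longrightarrow> q l t \<in> C"
        using d(2)[of l] that unfolding q_sym[of l t] by (auto simp: dist_real_def)
      consider "l = t" | "t = r" | "l < t" "t < r" using \<open>l \<le> t\<close> \<open>t \<le> r\<close> by linarith
      then show ?thesis using 1 2 q_trans \<open>l < r\<close> by cases blast+
    qed
    then show ?case using d(1) by (intro exI[of _ d]) (simp add: P_def)
  qed
  then show ?thesis using \<open>a < b\<close> by (simp add: P_def q_def)
qed

section \<open>Directional derivatives of C1 maps\<close>

lemma has_dir_deriv_unique:
  "has_dir_deriv f d x h \<Longrightarrow> dir_deriv f x h = d"
  unfolding has_dir_deriv_def dir_deriv_def by (intro tendsto_Lim) auto

lemma Ck_on_has_dir_deriv:
  assumes "Ck_on 1 U f" "x \<in> U"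
  shows "has_dir_deriv f (dir_deriv f x h) x h"
proof -
  obtain d where "has_dir_deriv (dir_derivs f []) d x h"
    using assms unfolding Ck_on_def by (metis less_one list.size(3))
  then show ?thesis by (simp add: has_dir_deriv_unique)
qed

text \<open>The continuity clause of \<open>Ck_on\<close> carries a whole sequence of directions.
  Composing with a constant sequence, which depends continuously on its value, removes it; the next
  lemma does the same for one direction.\<close>

lemma Ck_on_continuous:
  assumes "Ck_on k U f"
  shows "continuous_on U f"
proof -
  have "continuous_on (U \<times> UNIV) (\<lambda>(x, h :: nat \<Rightarrow> 'a). dir_derivs f (map h [0..<0]) x)"
    using assms unfolding Ck_on_def by blast
  then have *: "continuous_on (U \<times> UNIV) (\<lambda>p :: 'a \<times> (nat \<Rightarrow> 'a). f (fst p))"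
    by (simp add: case_prod_unfold)
  have "continuous_on U (\<lambda>x. f (fst (x, \<lambda>_::nat. x)))"
    by (rule continuous_on_compose2[OF *])
      (auto intro!: continuous_intros continuous_on_coordinatewise_then_product)
  then show ?thesis by simp
qed

lemma Ck_on_deriv_continuous:
  assumes "Ck_on 1 U f"
  shows "continuous_on (U \<times> UNIV) (\<lambda>(x, h). dir_deriv f x h)"
proof -
  have "continuous_on (U \<times> UNIV) (\<lambda>(x, h :: nat \<Rightarrow> 'a). dir_derivs f (map h [0..<1]) x)"
    using assms unfolding Ck_on_def by blast
  then have *: "continuous_on (U \<times> UNIV) (\<lambda>p :: 'a \<times> (nat \<Rightarrow> 'a). dir_deriv f (fst p) (snd p 0))"
    by (simp add: case_prod_unfold)
  have "continuous_on (U \<times> UNIV)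
      (\<lambda>p. dir_deriv f (fst (fst p, \<lambda>_::nat. snd p)) (snd (fst p, \<lambda>_::nat. snd p) 0))"
    by (rule continuous_on_compose2[OF *])
      (auto intro!: continuous_intros continuous_on_coordinatewise_then_product)
  then show ?thesis by (simp add: case_prod_unfold)
qed

lemma Ck_on_tendsto:
  assumes "Ck_on k U f" "(g \<longlongrightarrow> x) F" "x \<in> U"
  shows "((\<lambda>i. f (g i)) \<longlongrightarrow> f x) F"
proof -
  have "open U" using assms by (auto simp: Ck_on_def)
  then have "isCont f x"
    using Ck_on_continuous[OF assms(1)] assms(3) by (simp add: continuous_on_eq_continuous_at)
  then show ?thesis by (rule isCont_tendsto_compose) (rule assms)
qed

lemma Ck_on_deriv_tendsto:
  assumes "Ck_on 1 U f" "(g \<longlongrightarrow> x) F" "x \<in> U" "(k \<longlongrightarrow> h) F"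
  shows "((\<lambda>i. dir_deriv f (g i) (k i)) \<longlongrightarrow> dir_deriv f x h) F"
proof -
  have "open (U \<times> UNIV :: ('a \<times> 'a) set)" using assms by (auto simp: Ck_on_def open_Times)
  then have "isCont (\<lambda>(x, h). dir_deriv f x h) (x, h)"
    using Ck_on_deriv_continuous[OF assms(1)] assms(3) by (simp add: continuous_on_eq_continuous_at)
  from isCont_tendsto_compose[OF this tendsto_Pair[OF assms(2,4)]] show ?thesis by simp
qed

text \<open>By joint continuity the derivative stays in a convex neighborhood \<open>C\<close> of
  its limit value for all base points in a convex set and directions near \<open>k0\<close>. The
  mean value theorem along the segment from \<open>x i\<close> to
  \<open>x i + \<sigma> i *\<^sub>R k i\<close> then places the quotient in
  \<open>C\<close>.\<close>

lemma Ck_on_difference_quotient: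
  fixes f :: "'a::frechet_space \<Rightarrow> 'b::frechet_space"
  assumes f: "Ck_on 1 U f" and "x0 \<in> U"
    and x: "(x \<longlongrightarrow> x0) F" and k: "(k \<longlongrightarrow> k0) F"
    and \<sigma>: "(\<sigma> \<longlongrightarrow> 0) F" "\<forall>\<^sub>F i in F. \<sigma> i \<noteq> 0"
  shows "((\<lambda>i. (1 / \<sigma> i) *\<^sub>R (f (x i + \<sigma> i *\<^sub>R k i) - f (x i))) \<longlongrightarrow> dir_deriv f x0 k0) F"
proof (rule topological_tendstoI)
  fix W assume "open W" "dir_deriv f x0 k0 \<in> W"
  then obtain C where C: "open C" "convex C" "dir_deriv f x0 k0 \<in> C" "C \<subseteq> W"
    by (rule locally_convex_at)
  let ?D = "\<lambda>(x, h). dir_deriv f x h"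
  have "open (U \<times> UNIV :: ('a \<times> 'a) set)" using f by (auto simp: Ck_on_def open_Times)
  then have "open (?D -` C \<inter> U \<times> UNIV)"
    using continuous_on_open_vimage Ck_on_deriv_continuous[OF f] C(1) by blast
  then obtain B0 K where BK: "open B0" "open K" "x0 \<in> B0" "k0 \<in> K" "B0 \<times> K \<subseteq> ?D -` C \<inter> U \<times> UNIV"
    by (rule open_prod_elim[of _ "(x0, k0)"]) (use C(3) \<open>x0 \<in> U\<close> in auto)
  \<comment> \<open>Only the base points run through a segment, while the direction is fixed along
    it. So \<open>B\<close> must be convex, but \<open>K\<close> need not be.\<close>
  obtain B where B: "open B" "convex B" "x0 \<in> B" "B \<subseteq> B0"
    using locally_convex_at BK by metis
  have "((\<lambda>i. x i + \<sigma> i *\<^sub>R k i) \<longlongrightarrow> x0 + 0 *\<^sub>R k0) F"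
    by (intro tendsto_add_frechet x tendsto_scaleR_frechet \<sigma> k)
  then have "\<forall>\<^sub>F i in F. x i + \<sigma> i *\<^sub>R k i \<in> B"
    using B by (auto dest: topological_tendstoD)
  moreover have "\<forall>\<^sub>F i in F. x i \<in> B" "\<forall>\<^sub>F i in F. k i \<in> K"
    using topological_tendstoD x k B BK by metis+
  ultimately show "\<forall>\<^sub>F i in F. (1 / \<sigma> i) *\<^sub>R (f (x i + \<sigma> i *\<^sub>R k i) - f (x i)) \<in> W"
    using \<sigma>(2)
  proof eventually_elim
    case (elim i)
    define \<phi> where "\<phi> \<tau> = f (x i + \<tau> *\<^sub>R k i)" for \<tau>
    define \<phi>' where "\<phi>' \<tau> = dir_deriv f (x i + \<tau> *\<^sub>R k i) (k i)" for \<tau>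
    have seg: "x i + \<tau> *\<^sub>R k i \<in> B" if \<tau>: "\<tau> \<in> closed_segment 0 (\<sigma> i)" for \<tau>
    proof -
      obtain u where u: "0 \<le> u" "u \<le> 1" "\<tau> = u * \<sigma> i"
        using \<tau> by (auto simp: closed_segment_def)
      have "(1 - u) *\<^sub>R x i + u *\<^sub>R (x i + \<sigma> i *\<^sub>R k i) \<in> B"
        using u elim by (intro convexD[OF B(2)]) auto
      also have "(1 - u) *\<^sub>R x i + u *\<^sub>R (x i + \<sigma> i *\<^sub>R k i) = x i + \<tau> *\<^sub>R k i"
        by (simp add: u algebra_simps)
      finally show ?thesis .
    qed
    have der: "has_curve_deriv \<phi> (\<phi>' \<tau>) \<tau> J" if "\<tau> \<in> closed_segment 0 (\<sigma> i)" for \<tau> J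
    proof -
      have "x i + \<tau> *\<^sub>R k i \<in> U" using seg[OF that] B BK by blast
      then have "has_dir_deriv f (\<phi>' \<tau>) (x i + \<tau> *\<^sub>R k i) (k i)"
        unfolding \<phi>'_def by (rule Ck_on_has_dir_deriv[OF f])
      then have *: "((\<lambda>t. (1 / t) *\<^sub>R (\<phi> (t + \<tau>) - \<phi> \<tau>)) \<longlongrightarrow> \<phi>' \<tau>) (at 0)"
        unfolding has_dir_deriv_def \<phi>_def by (simp add: algebra_simps)
      have "((\<lambda>s. (1 / (s - \<tau>)) *\<^sub>R (\<phi> s - \<phi> \<tau>)) \<longlongrightarrow> \<phi>' \<tau>) (at \<tau>)"
        using * by (subst LIM_offset_zero_iff) (auto simp: add.commute)
      then show ?thesis
        unfolding has_curve_deriv_def by (rule tendsto_within_subset) simp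
    qed
    have in_C: "\<phi>' \<tau> \<in> C" if "\<tau> \<in> closed_segment 0 (\<sigma> i)" for \<tau>
    proof -
      have "(x i + \<tau> *\<^sub>R k i, k i) \<in> B0 \<times> K" using seg[OF that] B(4) elim by auto
      then show ?thesis using BK(5) by (auto simp: \<phi>'_def)
    qed
    have "(1 / \<sigma> i) *\<^sub>R (\<phi> (\<sigma> i) - \<phi> 0) \<in> C"
    proof (cases "\<sigma> i > 0")
      case True
      then show ?thesis
        using mean_value_convex[of 0 "\<sigma> i" \<phi> \<phi>' C] der in_C C by (simp add: closed_segment_eq_real_ivl)
    next
      case False
      then have "(1 / (0 - \<sigma> i)) *\<^sub>R (\<phi> 0 - \<phi> (\<sigma> i)) \<in> C"
        using elim by (intro mean_value_convex[of "\<sigma> i" 0 \<phi> \<phi>' C] der in_C C)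
          (auto simp: closed_segment_eq_real_ivl)
      also have "(1 / (0 - \<sigma> i)) *\<^sub>R (\<phi> 0 - \<phi> (\<sigma> i)) = (1 / \<sigma> i) *\<^sub>R (\<phi> (\<sigma> i) - \<phi> 0)"
        by (simp add: algebra_simps)
      finally show ?thesis .
    qed
    then show ?case using C(4) by (auto simp: \<phi>_def)
  qed
qed

text \<open>The increment along \<open>h + k\<close> is split at the moving point
  \<open>x + t *\<^sub>R h\<close>; the second part has a variable base point, which the strict
  quotient lemma permits.\<close>

lemma dir_deriv_add:
  assumes f: "Ck_on 1 U f" "x \<in> U"
  shows "dir_deriv f x (h + k) = dir_deriv f x h + dir_deriv f x k"
proof (rule has_dir_deriv_unique)
  have id0: "((\<lambda>t::real. t) \<longlongrightarrow> 0) (at 0)" by (rule tendsto_ident_at)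
  have nz: "\<forall>\<^sub>F t in at 0. t \<noteq> (0::real)" by (simp add: eventually_at_filter)
  have lim: "((\<lambda>t. x + t *\<^sub>R h) \<longlongrightarrow> x) (at 0)"
    using tendsto_add_frechet[OF tendsto_const tendsto_scaleR_frechet[OF id0 tendsto_const]] by fastforce
  have "((\<lambda>t. (1 / t) *\<^sub>R (f (x + t *\<^sub>R h) - f x)
      + (1 / t) *\<^sub>R (f (x + t *\<^sub>R h + t *\<^sub>R k) - f (x + t *\<^sub>R h)))
      \<longlongrightarrow> dir_deriv f x h + dir_deriv f x k) (at 0)"
    by (intro tendsto_add_frechet Ck_on_difference_quotient[OF f] lim id0 nz tendsto_const)
  moreover have "(1 / t) *\<^sub>R (f (x + t *\<^sub>R h) - f x)
      + (1 / t) *\<^sub>R (f (x + t *\<^sub>R h + t *\<^sub>R k) - f (x + t *\<^sub>R h))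
      = (1 / t) *\<^sub>R (f (x + t *\<^sub>R (h + k)) - f x)" for t
    unfolding scaleR_add_right[symmetric] by (simp add: scaleR_add_right add.assoc)
  ultimately show "has_dir_deriv f (dir_deriv f x h + dir_deriv f x k) x (h + k)"
    unfolding has_dir_deriv_def by simp
qed

lemma dir_deriv_scaleR:
  assumes f: "Ck_on 1 U f" "x \<in> U"
  shows "dir_deriv f x (a *\<^sub>R h) = a *\<^sub>R dir_deriv f x h"
proof (cases "a = 0")
  case True
  have "has_dir_deriv f 0 x 0" by (simp add: has_dir_deriv_def)
  then show ?thesis using True by (simp add: has_dir_deriv_unique)
next
  case False
  have id0: "((\<lambda>t. a * t) \<longlongrightarrow> 0) (at 0)"
    by (auto intro!: tendsto_eq_intros)
  have nz: "\<forall>\<^sub>F t in at 0. a * t \<noteq> (0::real)" using False by (simp add: eventually_at_filter)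
  have "((\<lambda>t. a *\<^sub>R (1 / (a * t)) *\<^sub>R (f (x + (a * t) *\<^sub>R h) - f x))
      \<longlongrightarrow> a *\<^sub>R dir_deriv f x h) (at 0)"
    by (intro tendsto_scaleR_frechet Ck_on_difference_quotient[OF f] id0 nz tendsto_const)
  then have "has_dir_deriv f (a *\<^sub>R dir_deriv f x h) x (a *\<^sub>R h)"
    unfolding has_dir_deriv_def using False by (simp add: mult.commute)
  then show ?thesis by (rule has_dir_deriv_unique)
qed

section \<open>Derivatives of curves\<close>

lemma has_curve_deriv_tendsto:
  assumes "has_curve_deriv c d t I"
  shows "(c \<longlongrightarrow> c t) (at t within I)"
proof -
  have "((\<lambda>s. c t + (s - t) *\<^sub>R (1 / (s - t)) *\<^sub>R (c s - c t)) \<longlongrightarrow> c t + (t - t) *\<^sub>R d) (at t within I)"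
    by (intro tendsto_add_frechet tendsto_const tendsto_scaleR_frechet tendsto_diff_frechet tendsto_ident_at
        assms[unfolded has_curve_deriv_def])
  moreover have "\<forall>\<^sub>F s in at t within I. c t + (s - t) *\<^sub>R (1 / (s - t)) *\<^sub>R (c s - c t) = c s"
    by (auto simp: eventually_at_filter)
  ultimately show ?thesis by (simp add: Lim_transform_eventually)
qed

lemma has_curve_deriv_cong:
  assumes "has_curve_deriv f d t I" "\<forall>\<^sub>F s in at t within I. f s = g s" "f t = g t"
  shows "has_curve_deriv g d t I"
  using assms(1) unfolding has_curve_deriv_def
  by (rule Lim_transform_eventually) (use assms(2) in eventually_elim, simp add: assms(3))

text \<open>The curve is written as \<open>c t\<close> plus \<open>s - t\<close> times its
  difference quotient. This quotient is a convergent direction, so no remainder term has to be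
  estimated.\<close>

lemma has_curve_deriv_chain:
  assumes f: "Ck_on 1 U f" "c t \<in> U" and c: "has_curve_deriv c d t I"
  shows "has_curve_deriv (\<lambda>s. f (c s)) (dir_deriv f (c t) d) t I"
proof -
  have "((\<lambda>s. s - t) \<longlongrightarrow> 0) (at t within I)" by (auto intro!: tendsto_eq_intros)
  moreover have "\<forall>\<^sub>F s in at t within I. s - t \<noteq> 0" by (simp add: eventually_at_filter)
  ultimately have "((\<lambda>s. (1 / (s - t)) *\<^sub>R
      (f (c t + (s - t) *\<^sub>R ((1 / (s - t)) *\<^sub>R (c s - c t))) - f (c t)))
      \<longlongrightarrow> dir_deriv f (c t) d) (at t within I)"
    by (intro Ck_on_difference_quotient[OF f] tendsto_const c[unfolded has_curve_deriv_def])
  then show ?thesis unfolding has_curve_deriv_def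
    by (rule Lim_transform_eventually) (auto simp: eventually_at_filter)
qed

lemma curve_deriv_eq:
  assumes "has_curve_deriv f d t I" "at t within I \<noteq> bot"
  shows "curve_deriv f t I = d"
  using assms unfolding has_curve_deriv_def curve_deriv_def by (intro tendsto_Lim)

lemma has_curve_deriv_unique:
  assumes "has_curve_deriv f d t I" "has_curve_deriv f e t I" "at t within I \<noteq> bot"
  shows "d = e"
  using assms curve_deriv_eq by metis

lemma has_curve_deriv_real:
  "has_curve_deriv f d t I \<longleftrightarrow> (f has_real_derivative d) (at t within I)"
  unfolding has_curve_deriv_def has_field_derivative_iff by (simp add: divide_inverse mult.commute)

lemma has_curve_deriv_const: "has_curve_deriv (\<lambda>s. a) 0 t I"
  by (simp add: has_curve_deriv_def)

lemma has_curve_deriv_add: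
  "has_curve_deriv f a t I \<Longrightarrow> has_curve_deriv g b t I \<Longrightarrow> has_curve_deriv (\<lambda>s. f s + g s) (a + b) t I"
  unfolding has_curve_deriv_def by (drule (1) tendsto_add_frechet) (simp add: algebra_simps)

lemma has_curve_deriv_scaleR:
  assumes a: "(a has_real_derivative a') (at t within I)" and f: "has_curve_deriv f f' t I"
  shows "has_curve_deriv (\<lambda>s. a s *\<^sub>R f s) (a' *\<^sub>R f t + a t *\<^sub>R f') t I"
proof -
  have "((\<lambda>s. ((a s - a t) / (s - t)) *\<^sub>R f s + a t *\<^sub>R (1 / (s - t)) *\<^sub>R (f s - f t))
      \<longlongrightarrow> a' *\<^sub>R f t + a t *\<^sub>R f') (at t within I)"
    using a f unfolding has_field_derivative_iff has_curve_deriv_def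
    by (intro tendsto_add_frechet tendsto_scaleR_frechet tendsto_const has_curve_deriv_tendsto[OF f])
  then show ?thesis
    unfolding has_curve_deriv_def by (simp add: algebra_simps diff_divide_distrib)
qed

lemma has_curve_deriv_diff:
  "has_curve_deriv f a t I \<Longrightarrow> has_curve_deriv g b t I \<Longrightarrow> has_curve_deriv (\<lambda>s. f s - g s) (a - b) t I"
  unfolding has_curve_deriv_def by (drule (1) tendsto_diff_frechet) (simp add: algebra_simps)

lemma has_curve_deriv_Pair:
  "has_curve_deriv f a t I \<Longrightarrow> has_curve_deriv g b t I \<Longrightarrow> has_curve_deriv (\<lambda>s. (f s, g s)) (a, b) t I"
  unfolding has_curve_deriv_def by (drule (1) tendsto_Pair) simp

lemma has_curve_deriv_affine: "has_curve_deriv (\<lambda>s. a + s *\<^sub>R h) h t I"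
  using has_curve_deriv_add[OF has_curve_deriv_const
      has_curve_deriv_scaleR[OF DERIV_ident has_curve_deriv_const]] by fastforce

lemma has_curve_deriv_rescale:
  assumes f: "has_curve_deriv f d (a * t) I" and I: "\<And>s. s \<in> J \<Longrightarrow> a * s \<in> I"
  shows "has_curve_deriv (\<lambda>s. f (a * s)) (a *\<^sub>R d) t J"
proof (cases "a = 0")
  case True
  then show ?thesis by (simp add: has_curve_deriv_const)
next
  case False
  have "filterlim (\<lambda>s. a * s) (at (a * t) within I) (at t within J)"
    unfolding filterlim_at using False I
    by (auto intro!: tendsto_eq_intros simp: eventually_at_filter)
  from filterlim_compose[OF f[unfolded has_curve_deriv_def] this]
  have "((\<lambda>s. a *\<^sub>R (1 / (a * s - a * t)) *\<^sub>R (f (a * s) - f (a * t))) \<longlongrightarrow> a *\<^sub>R d) (at t within J)"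
    by (intro tendsto_scaleR_frechet tendsto_const)
  then show ?thesis
    unfolding has_curve_deriv_def using False by (simp add: right_diff_distrib[symmetric])
qed

section \<open>Tangent vectors and charts\<close>

locale smooth_manifold =
  fixes A :: "('n::t2_space, 'e::frechet_space) chart set"
  assumes atlas: "smooth_atlas A"
begin

section \<open>Charts, transition maps and tangent vectors\<close>

lemma charts_atD: "c \<in> charts_at A p \<Longrightarrow> c \<in> A" "c \<in> charts_at A p \<Longrightarrow> p \<in> fst c"
  by (auto simp: charts_at_def)

lemma chart_exists: obtains c where "c \<in> charts_at A p"
  using atlas unfolding smooth_atlas_def charts_at_def by blast

lemma chart_homeo: "c \<in> A \<Longrightarrow> homeomorphism (fst c) (chart_image c) (snd c) (chart_inv c)"
  and open_chart: "c \<in> A \<Longrightarrow> open (fst c)"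
  and open_chart_image: "c \<in> A \<Longrightarrow> open (chart_image c)"
  using atlas unfolding smooth_atlas_def is_chart_def by blast+

lemma chart_inv_chart: "c \<in> A \<Longrightarrow> p \<in> fst c \<Longrightarrow> chart_inv c (snd c p) = p"
  using chart_homeo by (rule homeomorphism_apply1)

lemma chart_chart_inv: "c \<in> A \<Longrightarrow> y \<in> chart_image c \<Longrightarrow> snd c (chart_inv c y) = y"
  using chart_homeo by (rule homeomorphism_apply2)

lemma chart_in_image: "p \<in> fst c \<Longrightarrow> snd c p \<in> chart_image c"
  by (simp add: chart_image_def)

lemma chart_inv_in: "c \<in> A \<Longrightarrow> y \<in> chart_image c \<Longrightarrow> chart_inv c y \<in> fst c"
  using chart_homeo[of c] unfolding homeomorphism_def by blast

lemma chart_inv_tendsto: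
  assumes "c \<in> A" "y \<in> chart_image c" "(g \<longlongrightarrow> y) F"
  shows "((\<lambda>i. chart_inv c (g i)) \<longlongrightarrow> chart_inv c y) F"
proof -
  have "isCont (chart_inv c) y"
    using homeomorphism_cont2[OF chart_homeo] open_chart_image assms
    by (auto simp: continuous_on_eq_continuous_at)
  then show ?thesis by (rule isCont_tendsto_compose) (rule assms)
qed

lemma eventually_in_chart:
  "c \<in> A \<Longrightarrow> p \<in> fst c \<Longrightarrow> (\<beta> \<longlongrightarrow> p) F \<Longrightarrow> \<forall>\<^sub>F i in F. \<beta> i \<in> fst c"
  using open_chart topological_tendstoD by blast

lemma transition_chart: "c \<in> A \<Longrightarrow> p \<in> fst c \<Longrightarrow> transition c d (snd c p) = snd d p"
  by (simp add: transition_def chart_inv_chart)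

lemma transition_Ck: "c \<in> A \<Longrightarrow> d \<in> A \<Longrightarrow> Ck_on 1 (snd c ` (fst c \<inter> fst d)) (transition c d)"
  using atlas unfolding smooth_atlas_def smooth_on_def by blast

text \<open>Continuity of \<beta> is a separate hypothesis: outside its domain a chart map is
  arbitrary, so differentiability of \<open>snd c \<circ> \<beta>\<close> does not keep \<beta> in
  the domain near \<open>t\<close>.\<close>

lemma curve_change_chart:
  assumes c: "c \<in> charts_at A (\<beta> t)" and d: "d \<in> charts_at A (\<beta> t)"
    and cont: "(\<beta> \<longlongrightarrow> \<beta> t) (at t within I)"
    and der: "has_curve_deriv (snd c \<circ> \<beta>) h t I"
  shows "has_curve_deriv (snd d \<circ> \<beta>) (dir_deriv (transition c d) (snd c (\<beta> t)) h) t I"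
proof -
  have cd: "c \<in> A" "d \<in> A" "\<beta> t \<in> fst c" "\<beta> t \<in> fst d" using c d by (auto dest: charts_atD)
  have "has_curve_deriv (\<lambda>s. transition c d ((snd c \<circ> \<beta>) s))
      (dir_deriv (transition c d) ((snd c \<circ> \<beta>) t) h) t I"
    using cd by (intro has_curve_deriv_chain[OF transition_Ck _ der]) auto
  then have "has_curve_deriv (\<lambda>s. transition c d (snd c (\<beta> s)))
      (dir_deriv (transition c d) (snd c (\<beta> t)) h) t I"
    by (simp add: o_def)
  then show ?thesis
  proof (rule has_curve_deriv_cong)
    show "\<forall>\<^sub>F s in at t within I. transition c d (snd c (\<beta> s)) = (snd d \<circ> \<beta>) s"
      using eventually_in_chart[OF cd(1,3) cont] by eventually_elim (simp add: transition_chart cd)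
  qed (simp add: transition_chart cd)
qed

text \<open>Once every direction is realized by a curve, identities between derivatives of
  transition maps, such as the cocycle rule, reduce to uniqueness of the derivative of that curve in
  the last chart.\<close>

lemma tangent_curve_exists:
  assumes c: "c \<in> charts_at A p"
  obtains \<beta> where "\<beta> 0 = p" "(\<beta> \<longlongrightarrow> p) (at 0)" "has_curve_deriv (snd c \<circ> \<beta>) h 0 UNIV"
proof
  let ?g = "\<lambda>s. snd c p + s *\<^sub>R h"
  define \<beta> where "\<beta> = (\<lambda>s. chart_inv c (?g s))"
  have c': "c \<in> A" "p \<in> fst c" using c by (auto dest: charts_atD)
  have lim: "(?g \<longlongrightarrow> snd c p) (at 0)"
    using has_curve_deriv_tendsto[OF has_curve_deriv_affine, of "snd c p" h 0 UNIV] by simp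
  show "\<beta> 0 = p" using c' by (simp add: \<beta>_def chart_inv_chart)
  show "(\<beta> \<longlongrightarrow> p) (at 0)"
    using chart_inv_tendsto[OF c'(1) chart_in_image[OF c'(2)] lim] c'
    by (simp add: \<beta>_def chart_inv_chart)
  have "\<forall>\<^sub>F s in at 0. ?g s \<in> chart_image c"
    using lim open_chart_image[OF c'(1)] chart_in_image[OF c'(2)] by (rule topological_tendstoD)
  then have "\<forall>\<^sub>F s in at 0. ?g s = (snd c \<circ> \<beta>) s"
    by eventually_elim (simp add: \<beta>_def chart_chart_inv c')
  then show "has_curve_deriv (snd c \<circ> \<beta>) h 0 UNIV"
    by (rule has_curve_deriv_cong[OF has_curve_deriv_affine])
      (simp add: \<beta>_def chart_chart_inv chart_in_image c')
qed

lemma transition_deriv_cocycle: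
  assumes "c \<in> charts_at A p" "d \<in> charts_at A p" "e \<in> charts_at A p"
  shows "dir_deriv (transition d e) (snd d p) (dir_deriv (transition c d) (snd c p) h) =
    dir_deriv (transition c e) (snd c p) h"
proof -
  obtain \<beta> where \<beta>: "\<beta> 0 = p" "(\<beta> \<longlongrightarrow> p) (at 0)" "has_curve_deriv (snd c \<circ> \<beta>) h 0 UNIV"
    using tangent_curve_exists[OF assms(1)] .
  note ch = curve_change_chart[of _ \<beta> 0 _ UNIV, unfolded \<beta>(1)]
  show ?thesis
    using ch[OF assms(2,3) \<beta>(2) ch[OF assms(1,2) \<beta>(2,3)]] ch[OF assms(1,3) \<beta>(2,3)]
    by (rule has_curve_deriv_unique) simp
qed

lemma transition_deriv_id:
  assumes "c \<in> charts_at A p"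
  shows "dir_deriv (transition c c) (snd c p) h = h"
proof -
  obtain \<beta> where \<beta>: "\<beta> 0 = p" "(\<beta> \<longlongrightarrow> p) (at 0)" "has_curve_deriv (snd c \<circ> \<beta>) h 0 UNIV"
    using tangent_curve_exists[OF assms] .
  show ?thesis
    using curve_change_chart[of _ \<beta> 0 _ UNIV, unfolded \<beta>(1), OF assms assms \<beta>(2,3)] \<beta>(3)
    by (rule has_curve_deriv_unique) simp
qed

lemma tangent_of_in: "c \<in> charts_at A p \<Longrightarrow> tangent_of A p c h \<in> tangent_space A p"
  by (simp add: tangent_space_def tangent_of_def transition_deriv_cocycle)

lemma tangent_of_self: "c \<in> charts_at A p \<Longrightarrow> tangent_of A p c h c = h"
  by (simp add: tangent_of_def transition_deriv_id)

lemma tangent_of_component: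
  assumes "c \<in> charts_at A p" "v \<in> tangent_space A p"
  shows "tangent_of A p c (v c) = v"
proof
  fix d
  have "d \<in> charts_at A p \<Longrightarrow> v d = dir_deriv (transition c d) (snd c p) (v c)"
    "d \<notin> charts_at A p \<Longrightarrow> v d = 0"
    using assms unfolding tangent_space_def by blast+
  then show "tangent_of A p c (v c) d = v d"
    unfolding tangent_of_def by presburger
qed

lemma tangent_of_linear:
  assumes c: "c \<in> charts_at A p"
  shows "tangent_of A p c (h + k) = tangent_add (tangent_of A p c h) (tangent_of A p c k)"
    and "tangent_of A p c (a *\<^sub>R h) = tangent_scale a (tangent_of A p c h)"
proof -
  have d: "Ck_on 1 (snd c ` (fst c \<inter> fst d)) (transition c d)" "snd c p \<in> snd c ` (fst c \<inter> fst d)"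
    if "d \<in> charts_at A p" for d
    using charts_atD[OF c] charts_atD[OF that] transition_Ck[of c d] by simp_all
  show "tangent_of A p c (h + k) = tangent_add (tangent_of A p c h) (tangent_of A p c k)"
    by (rule ext) (simp add: tangent_of_def tangent_add_def dir_deriv_add[OF d])
  show "tangent_of A p c (a *\<^sub>R h) = tangent_scale a (tangent_of A p c h)"
    by (rule ext) (simp add: tangent_of_def tangent_scale_def dir_deriv_scaleR[OF d])
qed

lemma tangent_of_zero: "c \<in> charts_at A p \<Longrightarrow> tangent_of A p c 0 = tangent_zero"
  using tangent_of_linear(2)[of c p 0 0] by (simp add: tangent_scale_def tangent_zero_def)

lemma velocity_eq:
  assumes c: "c \<in> charts_at A (\<beta> t)"
    and cont: "(\<beta> \<longlongrightarrow> \<beta> t) (at t within I)"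
    and der: "has_curve_deriv (snd c \<circ> \<beta>) h t I" and I: "at t within I \<noteq> bot"
  shows "velocity A I \<beta> t = tangent_of A (\<beta> t) c h"
  using curve_deriv_eq[OF curve_change_chart[OF c _ cont der] I]
  by (auto simp: velocity_def tangent_of_def fun_eq_iff)

end

locale riemannian_manifold = smooth_manifold A
  for A :: "('n::t2_space, 'e::frechet_space) chart set" +
  fixes \<gamma> :: "('n, 'e) metric_tensor"
  assumes metric: "riemannian_metric A \<gamma>"
begin

abbreviation G where "G \<equiv> local_metric A \<gamma>"

section \<open>The metric in a chart\<close>

lemma metric_tangent_of:
  "c \<in> charts_at A p \<Longrightarrow> \<gamma> p (tangent_of A p c h) (tangent_of A p c k) = G c (snd c p) h k"
  by (simp add: local_metric_def chart_inv_chart charts_at_def)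

lemma chart_inv_charts_at: "c \<in> A \<Longrightarrow> y \<in> chart_image c \<Longrightarrow> c \<in> charts_at A (chart_inv c y)"
  by (simp add: charts_at_def chart_inv_in)

lemma metric_props:
  assumes "u \<in> tangent_space A p" "w \<in> tangent_space A p"
  shows "\<gamma> p u w = \<gamma> p w u" "\<gamma> p (tangent_scale a u) w = a * \<gamma> p u w"
    "z \<in> tangent_space A p \<Longrightarrow> \<gamma> p (tangent_add u w) z = \<gamma> p u z + \<gamma> p w z"
    "u \<noteq> tangent_zero \<Longrightarrow> \<gamma> p u u > 0"
  using metric assms unfolding riemannian_metric_def by blast+

lemma G_sym: "c \<in> A \<Longrightarrow> y \<in> chart_image c \<Longrightarrow> G c y h k = G c y k h"
  and G_add_left: "c \<in> A \<Longrightarrow> y \<in> chart_image c \<Longrightarrow> G c y (h + h') k = G c y h k + G c y h' k"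
  and G_scale_left: "c \<in> A \<Longrightarrow> y \<in> chart_image c \<Longrightarrow> G c y (a *\<^sub>R h) k = a * G c y h k"
  unfolding local_metric_def
  by (auto simp: tangent_of_linear chart_inv_charts_at intro!: metric_props tangent_of_in)

lemma G_add_right: "c \<in> A \<Longrightarrow> y \<in> chart_image c \<Longrightarrow> G c y h (k + k') = G c y h k + G c y h k'"
  using G_sym G_add_left by metis

lemma G_scale_right: "c \<in> A \<Longrightarrow> y \<in> chart_image c \<Longrightarrow> G c y h (a *\<^sub>R k) = a * G c y h k"
  using G_sym G_scale_left by metis

lemma G_zero: "c \<in> A \<Longrightarrow> y \<in> chart_image c \<Longrightarrow> G c y 0 k = 0" "c \<in> A \<Longrightarrow> y \<in> chart_image c \<Longrightarrow> G c y h 0 = 0"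
  using G_scale_left[of c y 0 0 k] G_scale_right[of c y h 0 0] by auto

lemma G_minus: "c \<in> A \<Longrightarrow> y \<in> chart_image c \<Longrightarrow> G c y (- h) k = - G c y h k"
  "c \<in> A \<Longrightarrow> y \<in> chart_image c \<Longrightarrow> G c y h (- k) = - G c y h k"
  using G_scale_left[of c y "-1" h k] G_scale_right[of c y h "-1" k] by auto

lemma G_diff: "c \<in> A \<Longrightarrow> y \<in> chart_image c \<Longrightarrow> G c y (h - h') k = G c y h k - G c y h' k"
  "c \<in> A \<Longrightarrow> y \<in> chart_image c \<Longrightarrow> G c y h (k - k') = G c y h k - G c y h k'"
  using G_add_left[of c y h "- h'" k] G_add_right[of c y h k "- k'"] by (auto simp: G_minus)

lemma G_pos:
  assumes "c \<in> A" "y \<in> chart_image c" "h \<noteq> 0"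
  shows "G c y h h > 0"
proof -
  let ?p = "chart_inv c y"
  have c: "c \<in> charts_at A ?p" using assms by (simp add: chart_inv_charts_at)
  have "tangent_of A ?p c h c \<noteq> 0" using assms c by (simp add: tangent_of_self)
  then have "tangent_of A ?p c h \<noteq> tangent_zero" by (auto simp: tangent_zero_def)
  then show ?thesis unfolding local_metric_def
    by (rule metric_props(4)[OF tangent_of_in[OF c] tangent_of_in[OF c]])
qed

lemma G_nonneg: "c \<in> A \<Longrightarrow> y \<in> chart_image c \<Longrightarrow> G c y h h \<ge> 0"
  using G_pos[of c y h] G_zero[of c y 0] by (cases "h = 0") auto

lemma G_Ck: "c \<in> A \<Longrightarrow> Ck_on 1 (chart_image c \<times> UNIV \<times> UNIV) (\<lambda>(y, h, k). G c y h k)"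
  using metric unfolding riemannian_metric_def smooth_on_def by blast

lemma G_tendsto:
  assumes "c \<in> A" "y0 \<in> chart_image c" "(y \<longlongrightarrow> y0) F" "(h \<longlongrightarrow> h0) F" "(k \<longlongrightarrow> k0) F"
  shows "((\<lambda>i. G c (y i) (h i) (k i)) \<longlongrightarrow> G c y0 h0 k0) F"
  using Ck_on_tendsto[OF G_Ck[OF assms(1)] tendsto_Pair[OF assms(3) tendsto_Pair[OF assms(4,5)]]] assms(2)
  by simp

lemma G_dir_deriv_base:
  "dir_deriv (\<lambda>(y, h, k). G c y h k) (y, h, k) (a, 0, 0) = dir_deriv (\<lambda>z. G c z h k) y a"
  by (simp add: dir_deriv_def)

text \<open>The increment \<open>(a i, 0, 0)\<close> moves the base point alone, while the vector
  arguments merely converge. In the Gauss lemma this yields the limit of the change of the metric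
  coefficients between two neighboring geodesics.\<close>

lemma G_difference_quotient:
  assumes c: "c \<in> A" "y0 \<in> chart_image c"
    and "(y \<longlongrightarrow> y0) F" "(h \<longlongrightarrow> h0) F" "(k \<longlongrightarrow> k0) F" "(a \<longlongrightarrow> a0) F"
    and "(\<sigma> \<longlongrightarrow> 0) F" "\<forall>\<^sub>F i in F. \<sigma> i \<noteq> 0"
  shows "((\<lambda>i. (G c (y i + \<sigma> i *\<^sub>R a i) (h i) (k i) - G c (y i) (h i) (k i)) / \<sigma> i)
    \<longlongrightarrow> dir_deriv (\<lambda>z. G c z h0 k0) y0 a0) F"
proof -
  have "((\<lambda>i. (1 / \<sigma> i) *\<^sub>R ((\<lambda>(y, h, k). G c y h k) ((y i, h i, k i) + \<sigma> i *\<^sub>R (a i, 0, 0))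
      - (\<lambda>(y, h, k). G c y h k) (y i, h i, k i)))
      \<longlongrightarrow> dir_deriv (\<lambda>(y, h, k). G c y h k) (y0, h0, k0) (a0, 0, 0)) F"
    using assms by (intro Ck_on_difference_quotient[OF G_Ck] tendsto_Pair tendsto_const) auto
  then show ?thesis by (simp add: G_dir_deriv_base)
qed

text \<open>The product rule: the derivative of the joint map is additive over the three slots, and
  in the two vector slots the map is linear, so its difference quotients are constant.\<close>

lemma G_curve_deriv:
  assumes c: "c \<in> A" "y t \<in> chart_image c"
    and y: "has_curve_deriv y y' t I" and h: "has_curve_deriv h h' t I"
    and k: "has_curve_deriv k k' t I"
  shows "((\<lambda>s. G c (y s) (h s) (k s)) has_real_derivative
    dir_deriv (\<lambda>z. G c z (h t) (k t)) (y t) y' + G c (y t) h' (k t) + G c (y t) (h t) k') (at t within I)"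
proof -
  let ?f = "\<lambda>(y, h, k). G c y h k"
  let ?x = "(y t, h t, k t)"
  note f = G_Ck[OF c(1)]
  have x: "?x \<in> chart_image c \<times> UNIV \<times> UNIV" using c by simp
  have split: "(y', h', k') = (y', 0, 0) + ((0, h', 0) + (0, 0, k'))" by simp
  have at0: "\<forall>\<^sub>F \<tau> in at (0::real). \<tau> \<noteq> 0" by (simp add: eventually_at_filter)
  have "has_dir_deriv ?f (G c (y t) h' (k t)) ?x (0, h', 0)"
    unfolding has_dir_deriv_def
    by (rule Lim_transform_eventually[OF tendsto_const])
      (use at0 in eventually_elim, simp add: G_add_left G_scale_left c)
  moreover have "has_dir_deriv ?f (G c (y t) (h t) k') ?x (0, 0, k')"
    unfolding has_dir_deriv_def
    by (rule Lim_transform_eventually[OF tendsto_const])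
      (use at0 in eventually_elim, simp add: G_add_right G_scale_right c)
  ultimately have "dir_deriv ?f ?x (y', h', k') =
      dir_deriv (\<lambda>z. G c z (h t) (k t)) (y t) y' + G c (y t) h' (k t) + G c (y t) (h t) k'"
    unfolding split dir_deriv_add[OF f x] G_dir_deriv_base by (simp add: has_dir_deriv_unique)
  moreover have "has_curve_deriv (\<lambda>s. ?f (y s, h s, k s)) (dir_deriv ?f ?x (y', h', k')) t I"
    using has_curve_deriv_chain[where c = "\<lambda>s. (y s, h s, k s)", OF f x] has_curve_deriv_Pair[OF y has_curve_deriv_Pair[OF h k]] by simp
  ultimately show ?thesis by (simp add: has_curve_deriv_real)
qed

section \<open>Geodesics: constant speed and rescaling\<close>

lemma geodesic_velocity:
  assumes "continuous_on {0..1} \<alpha>" "c \<in> A" "t \<in> {0..1}" "\<alpha> t \<in> fst c"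
    "has_curve_deriv (snd c \<circ> \<alpha>) h t {0..1}"
  shows "velocity A {0..1} \<alpha> t = tangent_of A (\<alpha> t) c h"
  using assms by (intro velocity_eq) (auto simp: charts_at_def continuous_on_def trivial_limit_within islimpt_Icc)

text \<open>In a chart the product rule gives the derivative of the metric coefficients along
  \<open>u'\<close> and two terms containing the acceleration \<open>- \<Gamma> c y u' u'\<close>;
  metric compatibility makes them cancel. Charts change along the curve, so the vanishing derivative
  is established locally and integrated afterwards.\<close>

lemma geodesic_speed_constant:
  assumes geo: "geodesic A \<gamma> {0..1} \<alpha>" and "t \<in> {0..1}"
  shows "\<gamma> (\<alpha> t) (velocity A {0..1} \<alpha> t) (velocity A {0..1} \<alpha> t) =
    \<gamma> (\<alpha> 0) (velocity A {0..1} \<alpha> 0) (velocity A {0..1} \<alpha> 0)"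
proof -
  define e where "e t = \<gamma> (\<alpha> t) (velocity A {0..1} \<alpha> t) (velocity A {0..1} \<alpha> t)" for t
  from geo obtain \<Gamma> where cont: "continuous_on {0..1} \<alpha>" and \<Gamma>: "levi_civita A \<gamma> \<Gamma>"
    and geo_eq: "\<forall>c\<in>A. \<exists>u'. \<forall>t\<in>{0..1}. \<alpha> t \<in> fst c \<longrightarrow>
           has_curve_deriv (snd c \<circ> \<alpha>) (u' t) t {0..1} \<and>
           has_curve_deriv u' (- \<Gamma> c (snd c (\<alpha> t)) (u' t) (u' t)) t {0..1}"
    unfolding geodesic_def by blast
  have "(e has_real_derivative 0) (at t within {0..1})" if t: "t \<in> {0..1}" for t
  proof -
    obtain c where c: "c \<in> charts_at A (\<alpha> t)" by (rule chart_exists)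
    then have c': "c \<in> A" "\<alpha> t \<in> fst c" by (auto dest: charts_atD)
    from geo_eq c'(1) obtain u' where
      u: "\<And>t. t \<in> {0..1} \<Longrightarrow> \<alpha> t \<in> fst c \<Longrightarrow> has_curve_deriv (snd c \<circ> \<alpha>) (u' t) t {0..1}" and
      u': "\<And>t. t \<in> {0..1} \<Longrightarrow> \<alpha> t \<in> fst c \<Longrightarrow>
        has_curve_deriv u' (- \<Gamma> c (snd c (\<alpha> t)) (u' t) (u' t)) t {0..1}"
      by blast
    let ?y = "snd c \<circ> \<alpha>"
    have y: "?y t \<in> chart_image c" using c'(2) by (simp add: chart_in_image)
    have e: "e s = G c (?y s) (u' s) (u' s)" if "s \<in> {0..1}" "\<alpha> s \<in> fst c" for s
      using that c'(1)
      by (simp add: e_def geodesic_velocity[OF cont c'(1) that u] metric_tangent_of charts_at_def)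
    have compat: "dir_deriv (\<lambda>z. G c z (u' t) (u' t)) (?y t) (u' t) =
        G c (?y t) (\<Gamma> c (?y t) (u' t) (u' t)) (u' t) + G c (?y t) (u' t) (\<Gamma> c (?y t) (u' t) (u' t))"
      using \<Gamma> c'(1) y unfolding levi_civita_def by blast
    have "((\<lambda>s. G c (?y s) (u' s) (u' s)) has_real_derivative 0) (at t within {0..1})"
      using G_curve_deriv[where y = "?y" and h = u' and k = u',
          OF c'(1) y u[OF t c'(2)] u'[OF t c'(2)] u'[OF t c'(2)]]
      unfolding compat using y c'(1) by (simp add: G_minus)
    moreover have "\<forall>\<^sub>F s in at t within {0..1}. \<alpha> s \<in> fst c"
      using cont t c' by (intro eventually_in_chart[where p = "\<alpha> t"]) (auto simp: continuous_on_def)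
    then have "\<forall>\<^sub>F s in at t within {0..1}. G c (?y s) (u' s) (u' s) = e s"
      unfolding eventually_at_filter by eventually_elim (simp add: e)
    ultimately show ?thesis
      unfolding has_curve_deriv_real[symmetric]
      by (rule has_curve_deriv_cong) (simp add: e[OF t c'(2)])
  qed
  then obtain k where "\<And>t. t \<in> {0..1} \<Longrightarrow> e t = k"
    using has_field_derivative_zero_constant[of "{0..1}" e] by (auto simp: has_field_derivative_def)
  then show ?thesis using \<open>t \<in> {0..1}\<close> by (simp add: e_def)
qed

text \<open>The acceleration acquires the factor \<open>a * a\<close>, and so does the Christoffel
  term by bilinearity. The case \<open>a = 0\<close> is included and gives the constant curve at
  \<open>x\<close>.\<close>

lemma geodesic_from_rescale:
  assumes geo: "geodesic_from A \<gamma> x v \<alpha>" and a: "a \<in> {0..1}"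
  shows "geodesic_from A \<gamma> x (tangent_scale a v) (\<lambda>t. \<alpha> (a * t))"
proof -
  from geo obtain \<Gamma> where cont: "continuous_on {0..1} \<alpha>" and \<Gamma>: "levi_civita A \<gamma> \<Gamma>"
    and geo_eq: "\<forall>c\<in>A. \<exists>u'. \<forall>t\<in>{0..1}. \<alpha> t \<in> fst c \<longrightarrow>
           has_curve_deriv (snd c \<circ> \<alpha>) (u' t) t {0..1} \<and>
           has_curve_deriv u' (- \<Gamma> c (snd c (\<alpha> t)) (u' t) (u' t)) t {0..1}"
    and \<alpha>0: "\<alpha> 0 = x" "velocity A {0..1} \<alpha> 0 = v"
    unfolding geodesic_from_def geodesic_def by blast
  have at: "a * t \<in> {0..1}" if "t \<in> {0..1}" for t
    using a that by (auto simp: mult_le_one)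
  let ?\<beta> = "\<lambda>t. \<alpha> (a * t)"
  have cont': "continuous_on {0..1} ?\<beta>"
    using at by (intro continuous_on_compose2[OF cont] continuous_intros) auto
  have geo': "\<exists>u'. \<forall>t\<in>{0..1}. ?\<beta> t \<in> fst c \<longrightarrow>
           has_curve_deriv (snd c \<circ> ?\<beta>) (u' t) t {0..1} \<and>
           has_curve_deriv u' (- \<Gamma> c (snd c (?\<beta> t)) (u' t) (u' t)) t {0..1}" if c: "c \<in> A" for c
  proof -
    from geo_eq c obtain u' where
      u: "\<And>t. t \<in> {0..1} \<Longrightarrow> \<alpha> t \<in> fst c \<Longrightarrow> has_curve_deriv (snd c \<circ> \<alpha>) (u' t) t {0..1}" and
      u': "\<And>t. t \<in> {0..1} \<Longrightarrow> \<alpha> t \<in> fst c \<Longrightarrow>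
        has_curve_deriv u' (- \<Gamma> c (snd c (\<alpha> t)) (u' t) (u' t)) t {0..1}"
      by blast
    have "has_curve_deriv (snd c \<circ> ?\<beta>) (a *\<^sub>R u' (a * t)) t {0..1} \<and>
        has_curve_deriv (\<lambda>t. a *\<^sub>R u' (a * t))
          (- \<Gamma> c (snd c (?\<beta> t)) (a *\<^sub>R u' (a * t)) (a *\<^sub>R u' (a * t))) t {0..1}"
      if t: "t \<in> {0..1}" "?\<beta> t \<in> fst c" for t
    proof
      show "has_curve_deriv (snd c \<circ> ?\<beta>) (a *\<^sub>R u' (a * t)) t {0..1}"
        using has_curve_deriv_rescale[where J = "{0..1}", OF u[OF at[OF t(1)] t(2)] at] by (simp add: o_def)
      have "snd c (?\<beta> t) \<in> chart_image c" using t by (simp add: chart_in_image)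
      then have lin: "linear (\<lambda>k. \<Gamma> c (snd c (?\<beta> t)) h k)" "linear (\<lambda>k. \<Gamma> c (snd c (?\<beta> t)) k h)" for h
        using \<Gamma> c unfolding levi_civita_def connection_def by blast+
      show "has_curve_deriv (\<lambda>t. a *\<^sub>R u' (a * t))
          (- \<Gamma> c (snd c (?\<beta> t)) (a *\<^sub>R u' (a * t)) (a *\<^sub>R u' (a * t))) t {0..1}"
        using has_curve_deriv_scaleR[OF DERIV_const
            has_curve_deriv_rescale[where J = "{0..1}", OF u'[OF at[OF t(1)] t(2)] at]]
        by (simp add: linear_scale[OF lin(1)] linear_scale[OF lin(2)])
    qed
    then show ?thesis by (intro exI[of _ "\<lambda>t. a *\<^sub>R u' (a * t)"]) blast
  qed
  obtain c where c: "c \<in> charts_at A x" by (rule chart_exists)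
  then have c': "c \<in> A" "x \<in> fst c" by (auto dest: charts_atD)
  obtain h where h: "has_curve_deriv (snd c \<circ> \<alpha>) h 0 {0..1}"
    using geo_eq c' \<alpha>0(1) by (metis atLeastAtMost_iff order_refl zero_le_one)
  have h': "has_curve_deriv (snd c \<circ> ?\<beta>) (a *\<^sub>R h) 0 {0..1}"
    using has_curve_deriv_rescale[of "snd c \<circ> \<alpha>" h a 0 "{0..1}" "{0..1}"] h at by (simp add: o_def)
  have "velocity A {0..1} ?\<beta> 0 = tangent_scale a v"
    using geodesic_velocity[OF cont c'(1) _ _ h] geodesic_velocity[OF cont' c'(1) _ _ h'] c c' \<alpha>0
    by (simp add: tangent_of_linear)
  then show ?thesis
    unfolding geodesic_from_def geodesic_def using cont' \<Gamma> geo' \<alpha>0(1) by auto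
qed

lemma riem_exp_eq:
  assumes "riem_exp_exists A \<gamma> x v" "geodesic_from A \<gamma> x v \<alpha>"
  shows "riem_exp A \<gamma> x v = \<alpha> 1"
proof -
  have "\<beta> 1 = \<alpha> 1" if "geodesic_from A \<gamma> x v \<beta>" for \<beta>
    using assms that unfolding riem_exp_exists_def by (metis atLeastAtMost_iff order_refl zero_le_one)
  then show ?thesis unfolding riem_exp_def using assms(2) by (intro the_equality) blast+
qed

end

section \<open>The Gauss lemma\<close>

text \<open>The mean value theorem is put in a form indifferent to the order of the end points,
  because a parameter may approach \<open>t0\<close> from either side.\<close>

lemma difference_quotient_le:
  fixes f :: "real \<Rightarrow> real"
  assumes "a \<noteq> b"
    and der: "\<And>s. s \<in> closed_segment a b \<Longrightarrow> \<exists>m\<le>M. (f has_real_derivative m) (at s within closed_segment a b)"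
  shows "(f b - f a) / (b - a) \<le> M"
proof -
  have *: "(f r - f l) / (r - l) \<le> M"
    if "l < r" and ex: "\<And>s. s \<in> {l..r} \<Longrightarrow> \<exists>m\<le>M. (f has_real_derivative m) (at s within {l..r})" for l r
  proof -
    obtain m where m: "\<And>s. s \<in> {l..r} \<Longrightarrow> m s \<le> M"
      "\<And>s. s \<in> {l..r} \<Longrightarrow> (f has_real_derivative m s) (at s within {l..r})"
      using ex by metis
    obtain s where s: "s \<in> {l<..<r}" "f r - f l = m s * (r - l)"
      using mvt_simple[OF \<open>l < r\<close>, of f "\<lambda>s. (*) (m s)"] m(2)
      by (auto simp: has_field_derivative_def)
    then show ?thesis using m(1)[of s] \<open>l < r\<close> by auto
  qed
  consider "a < b" | "b < a" using \<open>a \<noteq> b\<close> by linarith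
  then show ?thesis
  proof cases
    case 1
    then show ?thesis using * der by (simp add: closed_segment_eq_real_ivl)
  next
    case 2
    then have "(f a - f b) / (a - b) \<le> M" using * der by (simp add: closed_segment_eq_real_ivl)
    moreover have "(f a - f b) / (a - b) = (f b - f a) / (b - a)"
      by (metis minus_diff_eq minus_divide_divide)
    ultimately show ?thesis by simp
  qed
qed

locale normal_neighborhood = riemannian_manifold A \<gamma>
  for A :: "('n::t2_space, 'e::frechet_space) chart set" and \<gamma> :: "('n, 'e) metric_tensor" +
  fixes x :: 'n and U :: "('n, 'e) tangent set" and V :: "'n set" and c :: "('n, 'e) chart"
  assumes normal: "normalizable_on A \<gamma> x U V" and c: "c \<in> charts_at A x"
begin

text \<open>
  The tangent space at \<open>x\<close> is read in the chart \<open>c\<close>: \<open>Uc\<close> and \<open>Phi\<close> are \<open>U\<close> and \<open>exp\<close> there,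
  \<open>dPhi\<close> is the derivative of \<open>exp\<close> with values in tangent vectors, and \<open>Phi_in d\<close> is \<open>exp\<close> with
  values in the chart \<open>d\<close>.
\<close>

definition Uc :: "'e set" where "Uc = (\<lambda>v. v c) ` U"

definition Phi :: "'e \<Rightarrow> 'n" where "Phi h = riem_exp A \<gamma> x (tangent_of A x c h)"

definition Phi_in :: "('n, 'e) chart \<Rightarrow> 'e \<Rightarrow> 'e" where "Phi_in d h = snd d (Phi h)"

definition exp_dom :: "('n, 'e) chart \<Rightarrow> 'e set" where "exp_dom d = {h \<in> Uc. Phi h \<in> fst d}"

definition dPhi :: "'e \<Rightarrow> 'e \<Rightarrow> ('n, 'e) tangent" where
  "dPhi h z = velocity A UNIV (\<lambda>\<sigma>. Phi (h + \<sigma> *\<^sub>R z)) 0"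

abbreviation g0 :: "'e \<Rightarrow> 'e \<Rightarrow> real" where "g0 \<equiv> G c (snd c x)"

section \<open>The exponential mapping in charts\<close>

lemma c_in: "c \<in> A" "snd c x \<in> chart_image c"
  using charts_atD[OF c] by (auto simp: chart_in_image)

lemma U_tangent: "v \<in> U \<Longrightarrow> v \<in> tangent_space A x"
  using normal unfolding normalizable_on_def tangent_open_def by blast

lemma tangent_of_Uc: "h \<in> Uc \<Longrightarrow> tangent_of A x c h \<in> U"
  unfolding Uc_def using U_tangent c by (auto simp: tangent_of_component)

lemma open_Uc: "open Uc"
  using normal c unfolding normalizable_on_def tangent_open_def Uc_def by blast

lemma zero_Uc: "0 \<in> Uc"
  using normal unfolding normalizable_on_def Uc_def by (force simp: tangent_zero_def)

lemma convex_Uc: "convex Uc"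
  unfolding convex_def Uc_def
proof (clarify)
  fix u w and a b :: real
  assume "u \<in> U" "w \<in> U" "0 \<le> a" "0 \<le> b" "a + b = 1"
  then have "tangent_add (tangent_scale a u) (tangent_scale b w) \<in> U"
    using normal unfolding normalizable_on_def tangent_convex_def by blast
  then show "a *\<^sub>R u c + b *\<^sub>R w c \<in> (\<lambda>v. v c) ` U"
    by (rule rev_image_eqI) (simp add: tangent_add_def tangent_scale_def)
qed

lemma scale_Uc: "h \<in> Uc \<Longrightarrow> t \<in> {0..1} \<Longrightarrow> t *\<^sub>R h \<in> Uc"
  using convexD[OF convex_Uc zero_Uc, of h "1 - t" t] by simp

lemma Phi_Ck: "d \<in> A \<Longrightarrow> Ck_on 1 (exp_dom d) (Phi_in d)"
  using normal c unfolding normalizable_on_def C1_diffeo_def exp_dom_def Phi_in_def[abs_def] Phi_def Uc_def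
  by blast

lemma open_exp_dom: "d \<in> A \<Longrightarrow> open (exp_dom d)"
  using Phi_Ck unfolding Ck_on_def by blast

lemma exp_domI: "h \<in> Uc \<Longrightarrow> d \<in> charts_at A (Phi h) \<Longrightarrow> h \<in> exp_dom d"
  and exp_domD: "h \<in> exp_dom d \<Longrightarrow> h \<in> Uc" "h \<in> exp_dom d \<Longrightarrow> Phi_in d h \<in> chart_image d"
    "d \<in> A \<Longrightarrow> h \<in> exp_dom d \<Longrightarrow> d \<in> charts_at A (Phi h)"
  by (auto simp: exp_dom_def charts_at_def Phi_in_def chart_in_image)

text \<open>\<open>C1_diffeo\<close> speaks of \<open>exp\<close> only through charts. Continuity
  into the manifold is recovered because \<open>Ck_on\<close> includes openness of
  \<open>exp_dom d\<close>: points near \<open>h\<close> are still sent into the domain of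
  \<open>d\<close>, where \<open>chart_inv d\<close> undoes the chart.\<close>

lemma Phi_tendsto:
  assumes g: "(g \<longlongrightarrow> h) F" and h: "h \<in> Uc"
  shows "((\<lambda>i. Phi (g i)) \<longlongrightarrow> Phi h) F"
proof -
  obtain d where d: "d \<in> charts_at A (Phi h)" by (rule chart_exists)
  then have dA: "d \<in> A" by (rule charts_atD)
  have hd: "h \<in> exp_dom d" using h d by (rule exp_domI)
  have eq: "chart_inv d (Phi_in d k) = Phi k" if "k \<in> exp_dom d" for k
    using that dA by (simp add: Phi_in_def exp_dom_def chart_inv_chart)
  have "((\<lambda>i. chart_inv d (Phi_in d (g i))) \<longlongrightarrow> chart_inv d (Phi_in d h)) F"
    using hd by (intro chart_inv_tendsto dA exp_domD Ck_on_tendsto[OF Phi_Ck g])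
  moreover have "\<forall>\<^sub>F i in F. g i \<in> exp_dom d"
    using g open_exp_dom[OF dA] hd by (rule topological_tendstoD)
  then have "\<forall>\<^sub>F i in F. chart_inv d (Phi_in d (g i)) = Phi (g i)"
    by eventually_elim (rule eq)
  ultimately show ?thesis by (simp add: eq[OF hd] Lim_transform_eventually)
qed

lemma Phi_in_curve:
  assumes "d \<in> A" "\<eta> t \<in> exp_dom d" "has_curve_deriv \<eta> z t I"
  shows "has_curve_deriv (\<lambda>s. Phi_in d (\<eta> s)) (dir_deriv (Phi_in d) (\<eta> t) z) t I"
  using assms by (intro has_curve_deriv_chain[OF Phi_Ck])

lemma velocity_Phi_in:
  assumes \<eta>: "has_curve_deriv \<eta> z t I" and I: "at t within I \<noteq> bot" and "\<eta> t \<in> exp_dom d" "d \<in> A"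
  shows "velocity A I (\<lambda>s. Phi (\<eta> s)) t = tangent_of A (Phi (\<eta> t)) d (dir_deriv (Phi_in d) (\<eta> t) z)"
proof (rule velocity_eq)
  show "((\<lambda>s. Phi (\<eta> s)) \<longlongrightarrow> Phi (\<eta> t)) (at t within I)"
    using assms by (intro Phi_tendsto has_curve_deriv_tendsto[OF \<eta>] exp_domD)
  show "has_curve_deriv (snd d \<circ> (\<lambda>s. Phi (\<eta> s))) (dir_deriv (Phi_in d) (\<eta> t) z) t I"
    using Phi_in_curve[of d \<eta> t z I] assms by (simp add: o_def Phi_in_def)
qed (use assms exp_domD in auto)

lemma dPhi_eq:
  assumes "h \<in> exp_dom d" "d \<in> A"
  shows "dPhi h z = tangent_of A (Phi h) d (dir_deriv (Phi_in d) h z)"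
  using velocity_Phi_in[OF has_curve_deriv_affine[of h z 0 UNIV], of d] assms
  by (simp add: dPhi_def)

lemma dPhi_metric:
  assumes "h \<in> exp_dom d" "d \<in> A"
  shows "\<gamma> (Phi h) (dPhi h y) (dPhi h z) =
    G d (Phi_in d h) (dir_deriv (Phi_in d) h y) (dir_deriv (Phi_in d) h z)"
  using assms by (simp add: dPhi_eq metric_tangent_of exp_domD Phi_in_def)

lemma Phi_in_linear:
  assumes "h \<in> exp_dom d" "d \<in> A"
  shows "dir_deriv (Phi_in d) h (y + z) = dir_deriv (Phi_in d) h y + dir_deriv (Phi_in d) h z"
    and "dir_deriv (Phi_in d) h (a *\<^sub>R z) = a *\<^sub>R dir_deriv (Phi_in d) h z"
  using assms by (auto intro: dir_deriv_add dir_deriv_scaleR Phi_Ck)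

text \<open>Rescaling \<alpha> produces a geodesic with initial velocity \<open>t\<close> times the
  given one. That vector lies in \<open>U\<close> by convexity, so uniqueness identifies the end
  point with the value of \<open>exp\<close>.\<close>

lemma exp_scale:
  assumes "h \<in> Uc" "t \<in> {0..1}" "geodesic_from A \<gamma> x (tangent_of A x c h) \<alpha>"
  shows "Phi (t *\<^sub>R h) = \<alpha> t"
proof -
  have "riem_exp_exists A \<gamma> x (tangent_of A x c (t *\<^sub>R h))"
    using normal tangent_of_Uc[OF scale_Uc[OF assms(1,2)]] unfolding normalizable_on_def by blast
  moreover have "geodesic_from A \<gamma> x (tangent_of A x c (t *\<^sub>R h)) (\<lambda>s. \<alpha> (t * s))"
    using geodesic_from_rescale[OF assms(3,2)] c by (simp add: tangent_of_linear)
  ultimately show ?thesis unfolding Phi_def by (simp add: riem_exp_eq)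
qed

lemma at_within_unit: "t \<in> {0..1::real} \<Longrightarrow> at t within {0..1} \<noteq> bot"
  by (simp add: trivial_limit_within islimpt_Icc)

lemma radial_curve: "has_curve_deriv (\<lambda>t. t *\<^sub>R h) h t I"
  using has_curve_deriv_affine[of 0 h] by simp

text \<open>Although \<open>Phi\<close> is only C1, the radial derivative
  \<open>dir_deriv (Phi_in d) (t *\<^sub>R h) h\<close> is differentiable in \<open>t\<close>: it is
  the velocity of a geodesic, whose second derivative is supplied by the geodesic equation.\<close>

lemma radial_geodesic:
  assumes h: "h \<in> Uc"
  obtains \<Gamma> where "levi_civita A \<gamma> \<Gamma>"
    "\<And>d t. d \<in> A \<Longrightarrow> t \<in> {0..1} \<Longrightarrow> t *\<^sub>R h \<in> exp_dom d \<Longrightarrow>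
      has_curve_deriv (\<lambda>t. dir_deriv (Phi_in d) (t *\<^sub>R h) h)
        (- \<Gamma> d (Phi_in d (t *\<^sub>R h)) (dir_deriv (Phi_in d) (t *\<^sub>R h) h) (dir_deriv (Phi_in d) (t *\<^sub>R h) h))
        t {0..1}"
    "\<And>t. t \<in> {0..1} \<Longrightarrow> \<gamma> (Phi (t *\<^sub>R h)) (dPhi (t *\<^sub>R h) h) (dPhi (t *\<^sub>R h) h) = g0 h h"
proof -
  have "riem_exp_exists A \<gamma> x (tangent_of A x c h)"
    using normal tangent_of_Uc[OF h] unfolding normalizable_on_def by blast
  then obtain \<alpha> where geo: "geodesic_from A \<gamma> x (tangent_of A x c h) \<alpha>"
    unfolding riem_exp_exists_def by blast
  have \<alpha>: "\<alpha> t = Phi (t *\<^sub>R h)" if "t \<in> {0..1}" for t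
    using exp_scale[OF h that geo] by simp
  from geo obtain \<Gamma> where cont: "continuous_on {0..1} \<alpha>" and \<Gamma>: "levi_civita A \<gamma> \<Gamma>"
    and geo_eq: "\<forall>c\<in>A. \<exists>u'. \<forall>t\<in>{0..1}. \<alpha> t \<in> fst c \<longrightarrow>
           has_curve_deriv (snd c \<circ> \<alpha>) (u' t) t {0..1} \<and>
           has_curve_deriv u' (- \<Gamma> c (snd c (\<alpha> t)) (u' t) (u' t)) t {0..1}"
    and \<alpha>0: "\<alpha> 0 = x" "velocity A {0..1} \<alpha> 0 = tangent_of A x c h"
    unfolding geodesic_from_def geodesic_def by blast
  have der: "has_curve_deriv (snd d \<circ> \<alpha>) (dir_deriv (Phi_in d) (t *\<^sub>R h) h) t {0..1}"
    if "d \<in> A" "t \<in> {0..1}" "t *\<^sub>R h \<in> exp_dom d" for d t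
    by (rule has_curve_deriv_cong[OF Phi_in_curve[OF that(1,3) radial_curve]])
      (auto simp: eventually_at_filter Phi_in_def \<alpha> that(2)[simplified])
  have "has_curve_deriv (\<lambda>t. dir_deriv (Phi_in d) (t *\<^sub>R h) h)
        (- \<Gamma> d (Phi_in d (t *\<^sub>R h)) (dir_deriv (Phi_in d) (t *\<^sub>R h) h) (dir_deriv (Phi_in d) (t *\<^sub>R h) h))
        t {0..1}"
    if d: "d \<in> A" and t: "t \<in> {0..1}" "t *\<^sub>R h \<in> exp_dom d" for d t
  proof -
    from geo_eq d obtain u' where
      u: "\<And>t. t \<in> {0..1} \<Longrightarrow> \<alpha> t \<in> fst d \<Longrightarrow> has_curve_deriv (snd d \<circ> \<alpha>) (u' t) t {0..1}" and
      u': "\<And>t. t \<in> {0..1} \<Longrightarrow> \<alpha> t \<in> fst d \<Longrightarrow>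
        has_curve_deriv u' (- \<Gamma> d (snd d (\<alpha> t)) (u' t) (u' t)) t {0..1}"
      by blast
    \<comment> \<open>The function \<open>u'\<close> is tied to the curve only at parameters where
      the curve lies in \<open>d\<close>. It therefore agrees with the radial derivative merely near
      \<open>t\<close>, which is enough to transfer its derivative.\<close>
    have eq: "u' s = dir_deriv (Phi_in d) (s *\<^sub>R h) h" if "s \<in> {0..1}" "s *\<^sub>R h \<in> exp_dom d" for s
      using u[OF that(1)] der[OF d that] at_within_unit[OF that(1)] \<alpha>[OF that(1)] that(2)
      by (auto simp: exp_dom_def intro: has_curve_deriv_unique)
    have "\<forall>\<^sub>F s in at t within {0..1}. s *\<^sub>R h \<in> exp_dom d"
      using has_curve_deriv_tendsto[OF radial_curve] open_exp_dom[OF d] t(2) by (rule topological_tendstoD)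
    then have ev: "\<forall>\<^sub>F s in at t within {0..1}. u' s = dir_deriv (Phi_in d) (s *\<^sub>R h) h"
      unfolding eventually_at_filter by eventually_elim (simp add: eq)
    have "\<alpha> t \<in> fst d" "snd d (\<alpha> t) = Phi_in d (t *\<^sub>R h)"
      using t(2) \<alpha>[OF t(1)] by (simp_all add: exp_dom_def Phi_in_def)
    from u'[OF t(1) this(1), unfolded this(2) eq[OF t]] show ?thesis
      using ev eq[OF t] by (rule has_curve_deriv_cong)
  qed
  moreover have "\<gamma> (Phi (t *\<^sub>R h)) (dPhi (t *\<^sub>R h) h) (dPhi (t *\<^sub>R h) h) = g0 h h"
    if t: "t \<in> {0..1}" for t
  proof -
    obtain d where d: "d \<in> charts_at A (Phi (t *\<^sub>R h))" by (rule chart_exists)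
    have dA: "d \<in> A" using d by (rule charts_atD)
    have td: "t *\<^sub>R h \<in> exp_dom d" using exp_domI[OF scale_Uc[OF h t] d] .
    have "velocity A {0..1} \<alpha> t = tangent_of A (\<alpha> t) d (dir_deriv (Phi_in d) (t *\<^sub>R h) h)"
      using td by (intro geodesic_velocity cont dA t der) (auto simp: exp_dom_def \<alpha>[OF t])
    then have "velocity A {0..1} \<alpha> t = dPhi (t *\<^sub>R h) h"
      by (simp add: dPhi_eq[OF td dA] \<alpha>[OF t])
    moreover have "geodesic A \<gamma> {0..1} \<alpha>" using geo by (simp add: geodesic_from_def)
    ultimately show ?thesis
      using geodesic_speed_constant[of \<alpha> t] t \<alpha>0 \<alpha>[OF t] metric_tangent_of[OF c] by simp
  qed
  ultimately show ?thesis using \<Gamma> that by blast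
qed

text \<open>Differentiate \<open>inv (Phi_in d (h + s *\<^sub>R z)) = h + s *\<^sub>R z\<close> at
  \<open>s = 0\<close>: the chain rule gives 0 on the left, and the right side has derivative
  \<open>z\<close>.\<close>

lemma dPhi_injective:
  assumes h: "h \<in> Uc" and z: "dPhi h z = tangent_zero"
  shows "z = 0"
proof -
  obtain d where d: "d \<in> charts_at A (Phi h)" by (rule chart_exists)
  have dA: "d \<in> A" using d by (rule charts_atD)
  have hd: "h \<in> exp_dom d" using exp_domI[OF h d] .
  define inv where "inv y = the_inv_into U (riem_exp A \<gamma> x) (chart_inv d y) c" for y
  have bij: "bij_betw (riem_exp A \<gamma> x) U V"
    and inv: "Ck_on 1 (snd d ` (V \<inter> fst d)) inv"
    using normal c dA unfolding normalizable_on_def C1_diffeo_def inv_def[abs_def] by blast+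
  have left: "inv (Phi_in d k) = k" and im: "Phi_in d k \<in> snd d ` (V \<inter> fst d)" if "k \<in> exp_dom d" for k
  proof -
    have k: "tangent_of A x c k \<in> U" using that by (intro tangent_of_Uc exp_domD)
    have "chart_inv d (Phi_in d k) = Phi k"
      using that dA by (simp add: Phi_in_def exp_dom_def chart_inv_chart)
    then show "inv (Phi_in d k) = k"
      using the_inv_into_f_f[OF bij_betw_imp_inj_on[OF bij] k] tangent_of_self[OF c]
      by (simp add: inv_def Phi_def)
    show "Phi_in d k \<in> snd d ` (V \<inter> fst d)"
      using bij_betwE[OF bij] k that by (auto simp: Phi_in_def Phi_def exp_dom_def)
  qed
  have "dir_deriv (Phi_in d) h z = dPhi h z d"
    using d by (simp add: dPhi_eq[OF hd dA] tangent_of_self)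
  then have zero: "dir_deriv (Phi_in d) h z = 0" by (simp add: z tangent_zero_def)
  have "has_curve_deriv (\<lambda>s. inv (Phi_in d (h + s *\<^sub>R z)))
      (dir_deriv inv (Phi_in d (h + 0 *\<^sub>R z)) (dir_deriv (Phi_in d) (h + 0 *\<^sub>R z) z)) 0 UNIV"
    using hd im by (intro has_curve_deriv_chain[OF inv] Phi_in_curve dA has_curve_deriv_affine) auto
  \<comment> \<open>Writing the direction as \<open>0 *\<^sub>R 0\<close> lets homogeneity of the
    derivative of \<open>inv\<close> show that it vanishes there.\<close>
  then have "has_curve_deriv (\<lambda>s. inv (Phi_in d (h + s *\<^sub>R z))) (dir_deriv inv (Phi_in d h) (0 *\<^sub>R 0)) 0 UNIV"
    by (simp add: zero)
  then have *: "has_curve_deriv (\<lambda>s. inv (Phi_in d (h + s *\<^sub>R z))) 0 0 UNIV"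
    using dir_deriv_scaleR[OF inv im[OF hd], of 0 0] by simp
  have "((\<lambda>s. h + s *\<^sub>R z) \<longlongrightarrow> h + 0 *\<^sub>R z) (at 0)"
    by (rule has_curve_deriv_tendsto[OF has_curve_deriv_affine])
  then have "\<forall>\<^sub>F s in at 0. h + s *\<^sub>R z \<in> exp_dom d"
    using open_exp_dom[OF dA] hd by (auto dest: topological_tendstoD)
  then have "\<forall>\<^sub>F s in at 0. inv (Phi_in d (h + s *\<^sub>R z)) = h + s *\<^sub>R z"
    by eventually_elim (rule left)
  then have "has_curve_deriv (\<lambda>s. h + s *\<^sub>R z) 0 0 UNIV"
    by (intro has_curve_deriv_cong[OF *]) (simp_all add: left[OF hd])
  then show "z = 0"
    using has_curve_deriv_unique[OF has_curve_deriv_affine[of h z 0 UNIV]] by simp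
qed

text \<open>The vector \<open>dPhi (t *\<^sub>R \<omega>) (t *\<^sub>R z)\<close> is the variation
  field of exp(t (\<omega> + \<sigma> z)) at \<sigma> = 0, a Jacobi field in the smooth setting. It
  vanishes at \<open>t = 0\<close>, and at \<open>t = 1\<close> the pairing is the one in the Gauss
  lemma.\<close>

definition radial_pairing :: "'e \<Rightarrow> 'e \<Rightarrow> real \<Rightarrow> real" where
  "radial_pairing \<omega> z t = \<gamma> (Phi (t *\<^sub>R \<omega>)) (dPhi (t *\<^sub>R \<omega>) \<omega>) (dPhi (t *\<^sub>R \<omega>) (t *\<^sub>R z))"

text \<open>
  Since \<open>exp\<close> is only \<open>C\<^sup>1\<close>, the mixed derivatives of a variation through geodesics need not
  exist. Instead of exchanging derivatives, compare the squared speeds of the geodesics with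
  initial velocities \<open>\<omega>\<close> and \<open>\<omega> + \<sigma> z\<close>: both are constant, and in the expansion of
  their difference the only term that is not controlled to first order in \<open>\<sigma>\<close> is
  the squared norm of the difference of velocities, which has a sign.
\<close>

lemma radial_pairing_slope_le:
  assumes \<omega>: "\<omega> \<in> Uc" and t0: "t0 \<in> {0..1}" and "\<epsilon> > 0"
  shows "\<forall>\<^sub>F t in at t0 within {0..1}.
    (radial_pairing \<omega> z t - radial_pairing \<omega> z t0) / (t - t0) \<le> g0 \<omega> z + \<epsilon>"
proof -
  obtain d where "d \<in> charts_at A (Phi (t0 *\<^sub>R \<omega>))" by (rule chart_exists)
  then have d: "d \<in> A" and t0d: "t0 *\<^sub>R \<omega> \<in> exp_dom d"
    using exp_domI[OF scale_Uc[OF \<omega> t0]] by (auto dest: charts_atD)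
  obtain \<Gamma> where \<Gamma>: "levi_civita A \<gamma> \<Gamma>"
    and accel: "\<And>t. t \<in> {0..1} \<Longrightarrow> t *\<^sub>R \<omega> \<in> exp_dom d \<Longrightarrow>
      has_curve_deriv (\<lambda>t. dir_deriv (Phi_in d) (t *\<^sub>R \<omega>) \<omega>)
        (- \<Gamma> d (Phi_in d (t *\<^sub>R \<omega>)) (dir_deriv (Phi_in d) (t *\<^sub>R \<omega>) \<omega>) (dir_deriv (Phi_in d) (t *\<^sub>R \<omega>) \<omega>))
        t {0..1}"
    using radial_geodesic[OF \<omega>] d by metis
  have \<Gamma>_Ck: "Ck_on 1 (chart_image d \<times> UNIV \<times> UNIV) (\<lambda>(y, h, k). \<Gamma> d y h k)"
    and \<Gamma>_lin: "\<And>y h. y \<in> chart_image d \<Longrightarrow> linear (\<lambda>k. \<Gamma> d y h k)"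
    and \<Gamma>_sym: "\<And>y h k. y \<in> chart_image d \<Longrightarrow> \<Gamma> d y h k = \<Gamma> d y k h"
    and compat: "\<And>y h k l. y \<in> chart_image d \<Longrightarrow> dir_deriv (\<lambda>z. G d z k l) y h =
        G d y (\<Gamma> d y h k) l + G d y k (\<Gamma> d y h l)"
    using \<Gamma> d unfolding levi_civita_def connection_def smooth_on_def by blast+
  define DF where "DF = dir_deriv (Phi_in d)"
  define u where "u t = Phi_in d (t *\<^sub>R \<omega>)" for t
  define p where "p t = DF (t *\<^sub>R \<omega>) \<omega>" for t
  define y where "y \<sigma> t = Phi_in d (t *\<^sub>R (\<omega> + \<sigma> *\<^sub>R z))" for \<sigma> t
  define P where "P \<sigma> t = DF (t *\<^sub>R (\<omega> + \<sigma> *\<^sub>R z)) (\<omega> + \<sigma> *\<^sub>R z)" for \<sigma> t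
  \<comment> \<open>\<open>K\<close> is the difference quotient, in the chart, whose limit is the
    variation field. For fixed \<sigma> it is differentiable in \<open>t\<close>, being a multiple
    of the difference of two geodesics; this is not known of the limit. \<open>H\<close> is the
    corresponding approximation of the pairing.\<close>
  define K where "K \<sigma> t = (1 / \<sigma>) *\<^sub>R (y \<sigma> t - u t)" for \<sigma> t
  define H where "H \<sigma> t = G d (u t) (p t) (K \<sigma> t)" for \<sigma> t
  define Q where "Q \<sigma> t k = (G d (u t + \<sigma> *\<^sub>R K \<sigma> t) (p t) k - G d (u t) (p t) k) / \<sigma>" for \<sigma> t k
  \<comment> \<open>\<open>B\<close> bounds the derivative of \<open>H \<sigma>\<close>. It results
    from solving the equation between the two constant squared speeds for the pairing of
    \<open>p t\<close> with \<open>P \<sigma> t - p t\<close>, dividing by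
    \<open>2 * \<sigma>\<close>, and moving the base point from \<open>y \<sigma> t\<close> to
    \<open>u t\<close> at the cost of the last \<open>Q\<close> term.\<close>
  define B where "B \<sigma> t = G d (u t) (p t) (\<Gamma> d (u t) (p t) (K \<sigma> t)) + g0 \<omega> z + \<sigma> / 2 * g0 z z
      - 1 / 2 * Q \<sigma> t (p t) - Q \<sigma> t (P \<sigma> t - p t)" for \<sigma> t
  define good where "good \<sigma> t \<longleftrightarrow> \<sigma> > 0 \<and> t \<in> {0..1} \<and> t *\<^sub>R \<omega> \<in> exp_dom d \<and> \<omega> + \<sigma> *\<^sub>R z \<in> Uc \<and>
      t *\<^sub>R (\<omega> + \<sigma> *\<^sub>R z) \<in> exp_dom d \<and> B \<sigma> t \<le> g0 \<omega> z + \<epsilon>" for \<sigma> t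
  have u_in: "u t \<in> chart_image d" if "t *\<^sub>R \<omega> \<in> exp_dom d" for t
    using that by (simp add: u_def exp_domD)
  have y_in: "y \<sigma> t \<in> chart_image d" if "t *\<^sub>R (\<omega> + \<sigma> *\<^sub>R z) \<in> exp_dom d" for \<sigma> t
    using that by (simp add: y_def exp_domD)
  have y_eq: "u t + \<sigma> *\<^sub>R K \<sigma> t = y \<sigma> t" if "\<sigma> > 0" for \<sigma> t
    using that by (simp add: K_def)
  have seg: "t *\<^sub>R (\<omega> + \<sigma> *\<^sub>R z) = t *\<^sub>R \<omega> + \<sigma> *\<^sub>R (t *\<^sub>R z)" for \<sigma> t
    by (simp add: scaleR_add_right mult.commute)

  have deriv: "\<exists>m\<le>g0 \<omega> z + \<epsilon>. (H \<sigma> has_real_derivative m) (at t within {0..1})"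
    if "good \<sigma> t" for \<sigma> t
  proof -
    have \<sigma>: "\<sigma> > 0" and t: "t \<in> {0..1}" and td: "t *\<^sub>R \<omega> \<in> exp_dom d"
      and Ut: "\<omega> + \<sigma> *\<^sub>R z \<in> Uc" and td': "t *\<^sub>R (\<omega> + \<sigma> *\<^sub>R z) \<in> exp_dom d"
      and le: "B \<sigma> t \<le> g0 \<omega> z + \<epsilon>"
      using that by (auto simp: good_def)
    note ui = u_in[OF td] and yi = y_in[OF td']
    let ?m = "dir_deriv (\<lambda>z. G d z (p t) (K \<sigma> t)) (u t) (p t)
      + G d (u t) (- \<Gamma> d (u t) (p t) (p t)) (K \<sigma> t)
      + G d (u t) (p t) ((1 / \<sigma>) *\<^sub>R (P \<sigma> t - p t))"
    have du: "has_curve_deriv u (p t) t {0..1}"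
      using Phi_in_curve[OF d td radial_curve] by (simp add: u_def[abs_def] p_def DF_def)
    have dy: "has_curve_deriv (y \<sigma>) (P \<sigma> t) t {0..1}"
      using Phi_in_curve[OF d td' radial_curve] by (simp add: y_def[abs_def] P_def DF_def)
    have dp: "has_curve_deriv p (- \<Gamma> d (u t) (p t) (p t)) t {0..1}"
      using accel[OF t td] by (simp add: u_def p_def[abs_def] DF_def)
    have dK: "has_curve_deriv (K \<sigma>) ((1 / \<sigma>) *\<^sub>R (P \<sigma> t - p t)) t {0..1}"
      using has_curve_deriv_scaleR[OF DERIV_const has_curve_deriv_diff[OF dy du], of "1 / \<sigma>"]
      by (simp add: K_def[abs_def])
    have "(H \<sigma> has_real_derivative ?m) (at t within {0..1})"
      using G_curve_deriv[OF d ui du dp dK] by (simp add: H_def[abs_def])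
    moreover have "?m \<le> B \<sigma> t"
    proof -
      let ?\<delta> = "P \<sigma> t - p t"
      have m: "?m = G d (u t) (p t) (\<Gamma> d (u t) (p t) (K \<sigma> t)) + G d (u t) (p t) ?\<delta> / \<sigma>"
        using ui d by (simp add: compat G_minus G_scale_right)
      have "G d (u t) (p t) (p t) = g0 \<omega> \<omega>"
        using radial_geodesic[OF \<omega>] t dPhi_metric[OF td d] by (metis u_def p_def DF_def)
      moreover have "G d (y \<sigma> t) (P \<sigma> t) (P \<sigma> t) = g0 (\<omega> + \<sigma> *\<^sub>R z) (\<omega> + \<sigma> *\<^sub>R z)"
        using radial_geodesic[OF Ut] t dPhi_metric[OF td' d] by (metis y_def P_def DF_def)
      moreover have "g0 (\<omega> + \<sigma> *\<^sub>R z) (\<omega> + \<sigma> *\<^sub>R z) = g0 \<omega> \<omega> + 2 * \<sigma> * g0 \<omega> z + \<sigma> * \<sigma> * g0 z z"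
        using c_in G_sym[OF c_in, of z \<omega>]
        by (simp add: G_add_left G_add_right G_scale_left G_scale_right algebra_simps)
      moreover have "G d (y \<sigma> t) (P \<sigma> t) (P \<sigma> t) = G d (y \<sigma> t) (p t) (p t)
          + 2 * G d (y \<sigma> t) (p t) ?\<delta> + G d (y \<sigma> t) ?\<delta> ?\<delta>"
        using G_sym[OF d yi, of "p t" "P \<sigma> t"] by (simp add: G_diff d yi)
      \<comment> \<open>This is the term that is discarded: \<open>P\<close> is merely continuous in
        \<sigma>, so after division by \<sigma> there is no control over its size, only over its
        sign.\<close>
      moreover have "G d (y \<sigma> t) ?\<delta> ?\<delta> \<ge> 0" by (rule G_nonneg[OF d yi])
      ultimately have "G d (y \<sigma> t) (p t) (p t) + 2 * G d (y \<sigma> t) (p t) ?\<delta>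
          \<le> G d (u t) (p t) (p t) + (2 * \<sigma> * g0 \<omega> z + \<sigma> * \<sigma> * g0 z z)"
        by simp
      then have "2 * G d (u t) (p t) ?\<delta> \<le> 2 * \<sigma> * g0 \<omega> z + \<sigma> * \<sigma> * g0 z z
          - (G d (y \<sigma> t) (p t) (p t) - G d (u t) (p t) (p t))
          - 2 * (G d (y \<sigma> t) (p t) ?\<delta> - G d (u t) (p t) ?\<delta>)"
        by simp
      also have "\<dots> = 2 * \<sigma> * (g0 \<omega> z + \<sigma> / 2 * g0 z z - 1 / 2 * Q \<sigma> t (p t) - Q \<sigma> t ?\<delta>)"
        using \<sigma> by (simp add: Q_def y_eq field_simps)
      finally have "G d (u t) (p t) ?\<delta> / \<sigma> \<le> g0 \<omega> z + \<sigma> / 2 * g0 z z - 1 / 2 * Q \<sigma> t (p t) - Q \<sigma> t ?\<delta>"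
        using \<sigma> by (simp add: pos_divide_le_eq mult.commute)
      then show ?thesis unfolding m B_def by linarith
    qed
    ultimately show ?thesis using le by (intro exI[of _ ?m]) auto
  qed

  \<comment> \<open>The limit is taken jointly in \<sigma> and \<open>t\<close>, so that the bound
    on \<open>B\<close> holds for one \<sigma> along an entire segment of parameters. The filter in
    \<open>t\<close> is not punctured, since that segment contains \<open>t0\<close>.\<close>
  define FF where "FF = at_right (0::real) \<times>\<^sub>F inf (nhds t0) (principal {0..1})"
  have lim\<sigma>: "(fst \<longlongrightarrow> 0) FF"
    unfolding FF_def by (rule filterlim_mono[OF filterlim_fst at_within_le_nhds order_refl])
  have limt: "(snd \<longlongrightarrow> t0) FF"
    unfolding FF_def by (rule filterlim_mono[OF filterlim_snd inf_le1 order_refl])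
  have \<sigma>_pos: "\<forall>\<^sub>F i in FF. fst i > 0"
    unfolding FF_def by (rule eventually_compose_filterlim[OF _ filterlim_fst])
      (simp add: eventually_at_right_less)
  have t_in: "\<forall>\<^sub>F i in FF. snd i \<in> {0..1}"
    unfolding FF_def by (rule eventually_compose_filterlim[OF _ filterlim_snd])
      (simp add: eventually_inf_principal)
  have \<sigma>_nz: "\<forall>\<^sub>F i in FF. fst i \<noteq> 0" using \<sigma>_pos by eventually_elim simp
  have lim\<omega>: "((\<lambda>i. \<omega> + fst i *\<^sub>R z) \<longlongrightarrow> \<omega>) FF"
    using tendsto_add_frechet[OF tendsto_const tendsto_scaleR_frechet[OF lim\<sigma> tendsto_const], of \<omega> z]
    by simp
  have limt\<omega>: "((\<lambda>i. snd i *\<^sub>R \<omega>) \<longlongrightarrow> t0 *\<^sub>R \<omega>) FF"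
    by (rule tendsto_scaleR_frechet[OF limt tendsto_const])
  have limt\<omega>': "((\<lambda>i. snd i *\<^sub>R (\<omega> + fst i *\<^sub>R z)) \<longlongrightarrow> t0 *\<^sub>R \<omega>) FF"
    by (rule tendsto_scaleR_frechet[OF limt lim\<omega>])
  define u0 where "u0 = Phi_in d (t0 *\<^sub>R \<omega>)"
  define p0 where "p0 = DF (t0 *\<^sub>R \<omega>) \<omega>"
  define S0 where "S0 = DF (t0 *\<^sub>R \<omega>) (t0 *\<^sub>R z)"
  have u0: "u0 \<in> chart_image d" using t0d by (simp add: u0_def exp_domD)
  have limu: "((\<lambda>i. u (snd i)) \<longlongrightarrow> u0) FF"
    unfolding u_def u0_def by (rule Ck_on_tendsto[OF Phi_Ck[OF d] limt\<omega> t0d])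
  have limp: "((\<lambda>i. p (snd i)) \<longlongrightarrow> p0) FF"
    unfolding p_def p0_def DF_def
    by (rule Ck_on_deriv_tendsto[OF Phi_Ck[OF d] limt\<omega> t0d tendsto_const])
  have limP: "((\<lambda>i. P (fst i) (snd i)) \<longlongrightarrow> p0) FF"
    unfolding P_def p0_def DF_def
    by (rule Ck_on_deriv_tendsto[OF Phi_Ck[OF d] limt\<omega>' t0d lim\<omega>])
  have limK: "((\<lambda>i. K (fst i) (snd i)) \<longlongrightarrow> S0) FF"
    unfolding K_def y_def u_def S0_def DF_def seg
    by (rule Ck_on_difference_quotient[OF Phi_Ck[OF d] t0d limt\<omega>
          tendsto_scaleR_frechet[OF limt tendsto_const] lim\<sigma> \<sigma>_nz])
  have lim\<delta>: "((\<lambda>i. P (fst i) (snd i) - p (snd i)) \<longlongrightarrow> 0) FF"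
    using tendsto_diff_frechet[OF limP limp] by simp
  have lim\<Gamma>: "((\<lambda>i. \<Gamma> d (u (snd i)) (p (snd i)) (K (fst i) (snd i))) \<longlongrightarrow> \<Gamma> d u0 p0 S0) FF"
    using Ck_on_tendsto[OF \<Gamma>_Ck tendsto_Pair[OF limu tendsto_Pair[OF limp limK]]] u0 by simp
  have limQ: "((\<lambda>i. Q (fst i) (snd i) (k i)) \<longlongrightarrow> G d u0 (\<Gamma> d u0 S0 p0) k0 + G d u0 p0 (\<Gamma> d u0 S0 k0)) FF"
    if "(k \<longlongrightarrow> k0) FF" for k k0
    unfolding Q_def compat[OF u0, symmetric]
    by (rule G_difference_quotient[OF d u0 limu limp that limK lim\<sigma> \<sigma>_nz])
  have "((\<lambda>i. B (fst i) (snd i)) \<longlongrightarrow> G d u0 p0 (\<Gamma> d u0 p0 S0) + g0 \<omega> z + 0 / 2 * g0 z z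
      - 1 / 2 * (G d u0 (\<Gamma> d u0 S0 p0) p0 + G d u0 p0 (\<Gamma> d u0 S0 p0))
      - (G d u0 (\<Gamma> d u0 S0 p0) 0 + G d u0 p0 (\<Gamma> d u0 S0 0))) FF"
    unfolding B_def
    by (intro tendsto_intros G_tendsto[OF d u0] limu limp lim\<Gamma> lim\<sigma> limQ lim\<delta>) auto
  \<comment> \<open>The two summands that stem from \<open>Q\<close> at \<open>p0\<close> coincide,
    and half of their sum cancels the first term by symmetry of \<Gamma>. The last bracket is zero
    because the difference of the velocities tends to 0.\<close>
  also have "G d u0 p0 (\<Gamma> d u0 p0 S0) + g0 \<omega> z + 0 / 2 * g0 z z
      - 1 / 2 * (G d u0 (\<Gamma> d u0 S0 p0) p0 + G d u0 p0 (\<Gamma> d u0 S0 p0))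
      - (G d u0 (\<Gamma> d u0 S0 p0) 0 + G d u0 p0 (\<Gamma> d u0 S0 0)) = g0 \<omega> z"
    using linear_0[OF \<Gamma>_lin[OF u0]] G_sym[OF d u0, of p0 "\<Gamma> d u0 S0 p0"] \<Gamma>_sym[OF u0, of p0 S0]
    by (simp add: G_zero[OF d u0])
  finally have "\<forall>\<^sub>F i in FF. B (fst i) (snd i) < g0 \<omega> z + \<epsilon>"
    using \<open>\<epsilon> > 0\<close> by (intro order_tendstoD) auto
  moreover have "\<forall>\<^sub>F i in FF. snd i *\<^sub>R \<omega> \<in> exp_dom d" "\<forall>\<^sub>F i in FF. \<omega> + fst i *\<^sub>R z \<in> Uc"
    "\<forall>\<^sub>F i in FF. snd i *\<^sub>R (\<omega> + fst i *\<^sub>R z) \<in> exp_dom d"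
    using topological_tendstoD[OF limt\<omega> open_exp_dom[OF d] t0d] topological_tendstoD[OF lim\<omega> open_Uc \<omega>]
      topological_tendstoD[OF limt\<omega>' open_exp_dom[OF d] t0d] by auto
  ultimately have "\<forall>\<^sub>F i in FF. good (fst i) (snd i)"
    using \<sigma>_pos t_in by eventually_elim (simp add: good_def)
  then obtain Pf Pg where Pf: "eventually Pf (at_right 0)"
    and Pg: "eventually Pg (inf (nhds t0) (principal {0..1}))"
    and PfPg: "\<And>\<sigma> t. Pf \<sigma> \<Longrightarrow> Pg t \<Longrightarrow> good \<sigma> t"
    unfolding FF_def eventually_prod_filter by auto
  obtain \<delta> where \<delta>: "\<delta> > 0" "\<And>t. dist t t0 < \<delta> \<Longrightarrow> t \<in> {0..1} \<Longrightarrow> Pg t"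
    using Pg unfolding eventually_inf_principal eventually_nhds_metric by blast
  have limH: "((\<lambda>\<sigma>. H \<sigma> t) \<longlongrightarrow> radial_pairing \<omega> z t) (at_right 0)" if Pgt: "Pg t" for t
  proof -
    \<comment> \<open>Any admissible \<sigma> will do; it only serves to read off that
      \<open>t *\<^sub>R \<omega>\<close> lies in \<open>exp_dom d\<close>, a condition free of
      \<sigma>.\<close>
    obtain \<sigma> where "good \<sigma> t"
      using eventually_happens'[OF trivial_limit_at_right_real Pf] PfPg[OF _ Pgt] by metis
    then have td: "t *\<^sub>R \<omega> \<in> exp_dom d" by (simp add: good_def)
    have "((\<lambda>\<sigma>. K \<sigma> t) \<longlongrightarrow> DF (t *\<^sub>R \<omega>) (t *\<^sub>R z)) (at 0)"
      using Ck_on_has_dir_deriv[OF Phi_Ck[OF d] td, of "t *\<^sub>R z"]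
      unfolding has_dir_deriv_def K_def y_def u_def DF_def seg .
    then have "((\<lambda>\<sigma>. K \<sigma> t) \<longlongrightarrow> DF (t *\<^sub>R \<omega>) (t *\<^sub>R z)) (at_right 0)"
      by (rule tendsto_within_subset) simp
    then have "((\<lambda>\<sigma>. H \<sigma> t) \<longlongrightarrow> G d (u t) (p t) (DF (t *\<^sub>R \<omega>) (t *\<^sub>R z))) (at_right 0)"
      unfolding H_def by (intro G_tendsto[OF d u_in[OF td]] tendsto_const)
    then show ?thesis
      by (simp add: radial_pairing_def dPhi_metric[OF td d] u_def p_def DF_def)
  qed
  \<comment> \<open>The order of limits matters: the mean value bound is used for
    \<open>H \<sigma>\<close> at fixed \<sigma>, and only then does \<sigma> tend to 0 with
    \<open>t\<close> fixed. Differentiability of \<open>radial_pairing\<close> is thus never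
    presupposed.\<close>
  have "(radial_pairing \<omega> z t - radial_pairing \<omega> z t0) / (t - t0) \<le> g0 \<omega> z + \<epsilon>"
    if t: "t \<in> {0..1}" "t \<noteq> t0" "dist t t0 < \<delta>" for t
  proof (rule tendsto_upperbound)
    have "Pg t" "Pg t0" using \<delta> t t0 by auto
    then show "((\<lambda>\<sigma>. (H \<sigma> t - H \<sigma> t0) / (t - t0)) \<longlongrightarrow>
        (radial_pairing \<omega> z t - radial_pairing \<omega> z t0) / (t - t0)) (at_right 0)"
      using t by (intro tendsto_intros limH) auto
    show "\<forall>\<^sub>F \<sigma> in at_right 0. (H \<sigma> t - H \<sigma> t0) / (t - t0) \<le> g0 \<omega> z + \<epsilon>"
      using Pf
    proof eventually_elim
      case (elim \<sigma>)
      have sub: "closed_segment t0 t \<subseteq> {0..1}"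
        using t t0 by (intro closed_segment_subset) auto
      have "\<exists>m\<le>g0 \<omega> z + \<epsilon>. (H \<sigma> has_real_derivative m) (at s within closed_segment t0 t)"
        if s: "s \<in> closed_segment t0 t" for s
      proof -
        have "dist s t0 \<le> dist t t0"
          using s by (auto simp: dist_real_def closed_segment_eq_real_ivl split: if_splits)
        then have "good \<sigma> s" using s sub t by (intro PfPg[OF elim] \<delta>) auto
        then show ?thesis using deriv DERIV_subset[OF _ sub] by blast
      qed
      then show ?case using t by (intro difference_quotient_le) auto
    qed
  qed simp
  then show ?thesis
    unfolding eventually_at using \<open>\<delta> > 0\<close> by (intro exI[of _ \<delta>]) auto
qed

lemma radial_pairing_minus:
  assumes "\<omega> \<in> Uc" "t \<in> {0..1}"
  shows "radial_pairing \<omega> (- z) t = - radial_pairing \<omega> z t"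
proof -
  obtain d where d: "d \<in> charts_at A (Phi (t *\<^sub>R \<omega>))" by (rule chart_exists)
  have dA: "d \<in> A" using d by (rule charts_atD)
  note td = exp_domI[OF scale_Uc[OF assms] d]
  have "dir_deriv (Phi_in d) (t *\<^sub>R \<omega>) (t *\<^sub>R (- z)) = - dir_deriv (Phi_in d) (t *\<^sub>R \<omega>) (t *\<^sub>R z)"
    using Phi_in_linear(2)[OF td dA, of "-1" "t *\<^sub>R z"] by simp
  then show ?thesis
    by (simp add: radial_pairing_def dPhi_metric[OF td dA] G_minus[OF dA exp_domD(2)[OF td]])
qed

lemma radial_pairing_deriv:
  assumes \<omega>: "\<omega> \<in> Uc" and t0: "t0 \<in> {0..1}"
  shows "(radial_pairing \<omega> z has_real_derivative g0 \<omega> z) (at t0 within {0..1})"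
  unfolding has_field_derivative_iff
proof (rule tendstoI)
  fix e :: real assume "e > 0"
  then have "\<forall>\<^sub>F t in at t0 within {0..1}.
      (radial_pairing \<omega> z' t - radial_pairing \<omega> z' t0) / (t - t0) \<le> g0 \<omega> z' + e / 2" for z'
    by (intro radial_pairing_slope_le[OF \<omega> t0]) simp
  from this[of z] this[of "- z"]
  have "\<forall>\<^sub>F t in at t0 within {0..1}. t \<in> {0..1} \<and>
      (radial_pairing \<omega> z t - radial_pairing \<omega> z t0) / (t - t0) \<le> g0 \<omega> z + e / 2 \<and>
      (radial_pairing \<omega> (- z) t - radial_pairing \<omega> (- z) t0) / (t - t0) \<le> g0 \<omega> (- z) + e / 2"
    unfolding eventually_at_filter by eventually_elim simp
  then show "\<forall>\<^sub>F t in at t0 within {0..1}.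
      dist ((radial_pairing \<omega> z t - radial_pairing \<omega> z t0) / (t - t0)) (g0 \<omega> z) < e"
  proof eventually_elim
    case (elim t)
    have "(radial_pairing \<omega> (- z) t - radial_pairing \<omega> (- z) t0) / (t - t0)
        = - ((radial_pairing \<omega> z t - radial_pairing \<omega> z t0) / (t - t0))"
      using elim t0 \<omega> by (simp add: radial_pairing_minus minus_divide_left)
    then show ?case
      using elim \<open>e > 0\<close> by (simp add: dist_real_def G_minus[OF c_in] abs_less_iff)
  qed
qed

text \<open>The pairing starts at 0, because the variation field vanishes at \<open>t = 0\<close>,
  and has constant slope; its value at \<open>t = 1\<close> is therefore the slope.\<close>

lemma gauss_lemma_radial:
  assumes \<omega>: "\<omega> \<in> Uc"
  shows "\<gamma> (Phi \<omega>) (dPhi \<omega> \<omega>) (dPhi \<omega> z) = g0 \<omega> z"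
proof -
  have "((\<lambda>t. radial_pairing \<omega> z t - t * g0 \<omega> z) has_real_derivative 0) (at t within {0..1})"
    if "t \<in> {0..1}" for t
    using radial_pairing_deriv[OF \<omega> that] by (auto intro!: derivative_eq_intros)
  then obtain k where k: "\<And>t. t \<in> {0..1} \<Longrightarrow> radial_pairing \<omega> z t - t * g0 \<omega> z = k"
    using has_field_derivative_zero_constant[of "{0..1}" "\<lambda>t. radial_pairing \<omega> z t - t * g0 \<omega> z"]
    by auto
  obtain d where d: "d \<in> charts_at A (Phi 0)" by (rule chart_exists)
  have dA: "d \<in> A" using d by (rule charts_atD)
  note zd = exp_domI[OF zero_Uc d]
  have "radial_pairing \<omega> z 0 = 0"
    using Phi_in_linear(2)[OF zd dA, of 0 0]
    by (simp add: radial_pairing_def dPhi_metric[OF zd dA] G_zero[OF dA exp_domD(2)[OF zd]])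
  then show ?thesis using k[of 0] k[of 1] by (simp add: radial_pairing_def)
qed

end

section \<open>Paths in polar coordinates\<close>

text \<open>The difference \<open>g - f'\<close> is continuous and nonnegative, so its integral is
  nonnegative and vanishes only if the difference vanishes everywhere.\<close>

lemma integral_ge_increment:
  fixes f f' g :: "real \<Rightarrow> real"
  assumes "a < b" and f: "\<And>s. s \<in> {a..b} \<Longrightarrow> (f has_real_derivative f' s) (at s within {a..b})"
    and f': "continuous_on {a..b} f'" and g: "continuous_on {a..b} g"
    and le: "\<And>s. s \<in> {a..b} \<Longrightarrow> f' s \<le> g s"
  shows "f b - f a \<le> integral {a..b} g"
    and "integral {a..b} g = f b - f a \<longleftrightarrow> (\<forall>s\<in>{a..b}. g s = f' s)"
proof -
  have "(f' has_integral f b - f a) {a..b}"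
    using \<open>a < b\<close> f
    by (intro fundamental_theorem_of_calculus) (auto simp: has_real_derivative_iff_has_vector_derivative)
  then have "integral {a..b} f' = f b - f a" by (rule integral_unique)
  moreover have int: "f' integrable_on {a..b}" "g integrable_on {a..b}"
    using f' g by (auto intro: integrable_continuous_real)
  ultimately have eq: "integral {a..b} (\<lambda>s. g s - f' s) = integral {a..b} g - (f b - f a)"
    using Henstock_Kurzweil_Integration.integral_diff[OF int(2,1)] by simp
  have "integral {a..b} (\<lambda>s. g s - f' s) \<ge> 0"
    using int le by (intro Henstock_Kurzweil_Integration.integral_nonneg integrable_diff) auto
  then show "f b - f a \<le> integral {a..b} g" using eq by simp
  have "integral {a..b} (\<lambda>s. g s - f' s) = 0 \<longleftrightarrow> (\<forall>s\<in>{a..b}. g s - f' s = 0)"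
    using \<open>a < b\<close> le by (intro integral_eq_0_iff continuous_intros f' g) auto
  then show "integral {a..b} g = f b - f a \<longleftrightarrow> (\<forall>s\<in>{a..b}. g s = f' s)" using eq by simp
qed

text \<open>If the end values differed, an open convex neighborhood of 0 could be chosen to avoid
  the nonzero difference quotient, contradicting \<open>mean_value_convex\<close>.\<close>

lemma has_curve_deriv_zero_constant:
  fixes f :: "real \<Rightarrow> 'a::frechet_space"
  assumes "a \<le> b" and f: "\<And>t. t \<in> {a..b} \<Longrightarrow> has_curve_deriv f 0 t {a..b}"
  shows "f b = f a"
proof (rule ccontr)
  assume "f b \<noteq> f a"
  then have ab: "a < b" using \<open>a \<le> b\<close> by (auto simp: order_less_le)
  let ?q = "(1 / (b - a)) *\<^sub>R (f b - f a)"
  have q: "?q \<noteq> 0" using \<open>f b \<noteq> f a\<close> ab by simp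
  obtain C where C: "open C" "convex C" "0 \<in> C" "C \<subseteq> - {?q}"
    by (rule locally_convex_at[of "- {?q}" 0]) (use q in auto)
  have "?q \<in> C" by (rule mean_value_convex[OF ab f _ C(1,2)]) (simp_all add: C(3))
  then show False using C(4) by auto
qed

lemma curve_deriv_C1:
  assumes "C1_curve_on I f" "\<And>t. t \<in> I \<Longrightarrow> at t within I \<noteq> bot"
  shows "continuous_on I (\<lambda>t. curve_deriv f t I)"
    and "t \<in> I \<Longrightarrow> has_curve_deriv f (curve_deriv f t I) t I"
proof -
  obtain f' where f': "continuous_on I f'" "\<And>t. t \<in> I \<Longrightarrow> has_curve_deriv f (f' t) t I"
    using assms(1) unfolding C1_curve_on_def by blast
  have eq: "curve_deriv f t I = f' t" if "t \<in> I" for t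
    using f'(2) assms(2) that by (intro curve_deriv_eq)
  show "continuous_on I (\<lambda>t. curve_deriv f t I)"
    using continuous_on_cong[THEN iffD2, OF refl eq f'(1)] .
  show "t \<in> I \<Longrightarrow> has_curve_deriv f (curve_deriv f t I) t I"
    using f'(2) eq by simp
qed

locale polar_path = normal_neighborhood A \<gamma> x U V c
  for A :: "('n::t2_space, 'e::frechet_space) chart set" and \<gamma> :: "('n, 'e) metric_tensor"
    and x :: 'n and U :: "('n, 'e) tangent set" and V :: "'n set" and c :: "('n, 'e) chart" +
  fixes r r' :: "real \<Rightarrow> real" and v :: "real \<Rightarrow> ('n, 'e) tangent" and \<alpha> :: "real \<Rightarrow> 'n"
  assumes r_deriv: "s \<in> {0..1} \<Longrightarrow> (r has_real_derivative r' s) (at s within {0..1})"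
    and r'_cont: "continuous_on {0..1} r'"
    and v_C1: "C1_tangent_path A x v"
    and r_nonneg: "s \<in> {0..1} \<Longrightarrow> r s \<ge> 0"
    and v_unit: "s \<in> {0..1} \<Longrightarrow> v s \<in> unit_sphere A \<gamma> x"
    and rv_in: "s \<in> {0..1} \<Longrightarrow> tangent_scale (r s) (v s) \<in> U"
    and \<alpha>_def: "s \<in> {0..1} \<Longrightarrow> \<alpha> s = riem_exp A \<gamma> x (tangent_scale (r s) (v s))"
begin

section \<open>The path and its speed in the fixed chart\<close>

definition w :: "real \<Rightarrow> 'e" where "w s = v s c"

definition w' :: "real \<Rightarrow> 'e" where "w' s = curve_deriv w s {0..1}"

definition \<eta> :: "real \<Rightarrow> 'e" where "\<eta> s = r s *\<^sub>R w s"

definition \<eta>' :: "real \<Rightarrow> 'e" where "\<eta>' s = r' s *\<^sub>R w s + r s *\<^sub>R w' s"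

definition speed :: "real \<Rightarrow> real" where
  "speed s = sqrt (\<gamma> (Phi (\<eta> s)) (dPhi (\<eta> s) (\<eta>' s)) (dPhi (\<eta> s) (\<eta>' s)))"

lemma w'_cont: "continuous_on {0..1} w'"
  and w_deriv: "s \<in> {0..1} \<Longrightarrow> has_curve_deriv w (w' s) s {0..1}"
proof -
  have "C1_curve_on {0..1} w"
    using v_C1 c unfolding C1_tangent_path_def w_def[abs_def] by blast
  note * = curve_deriv_C1[OF this at_within_unit]
  show "continuous_on {0..1} w'" using *(1) by (simp add: w'_def[abs_def])
  show "s \<in> {0..1} \<Longrightarrow> has_curve_deriv w (w' s) s {0..1}" using *(2) by (simp add: w'_def)
qed

lemma tangent_of_w: "s \<in> {0..1} \<Longrightarrow> tangent_of A x c (w s) = v s"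
  using v_unit c by (simp add: w_def tangent_of_component unit_sphere_def)

lemma g0_w: "s \<in> {0..1} \<Longrightarrow> g0 (w s) (w s) = 1"
  using v_unit[of s] tangent_of_w[of s] metric_tangent_of[OF c, of "w s" "w s"]
  by (auto simp: unit_sphere_def gnorm_def)

text \<open>Differentiate the constant function \<open>g0 (w s) (w s)\<close>, which is 1. The base
  point stays at \<open>x\<close>, so the metric coefficients contribute nothing.\<close>

lemma g0_w_w':
  assumes s: "s \<in> {0..1}"
  shows "g0 (w s) (w' s) = 0"
proof -
  have zero: "dir_deriv (\<lambda>z. G c z (w s) (w s)) (snd c x) 0 = 0"
    by (intro has_dir_deriv_unique) (simp add: has_dir_deriv_def)
  have "((\<lambda>t. g0 (w t) (w t)) has_real_derivative
      g0 (w' s) (w s) + g0 (w s) (w' s)) (at s within {0..1})"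
    using G_curve_deriv[where y = "\<lambda>_. snd c x", OF c_in has_curve_deriv_const w_deriv[OF s] w_deriv[OF s]]
    by (simp add: zero)
  moreover have "((\<lambda>t. g0 (w t) (w t)) has_real_derivative 0) (at s within {0..1})"
    unfolding has_curve_deriv_real[symmetric]
    by (rule has_curve_deriv_cong[OF has_curve_deriv_const[of 1]])
      (use s in \<open>auto simp: eventually_at_filter g0_w\<close>)
  ultimately have "g0 (w' s) (w s) + g0 (w s) (w' s) = 0"
    unfolding has_curve_deriv_real[symmetric]
    by (rule has_curve_deriv_unique) (rule at_within_unit[OF s])
  then show ?thesis using G_sym[OF c_in] by simp
qed

lemma \<eta>_tangent: "s \<in> {0..1} \<Longrightarrow> tangent_of A x c (\<eta> s) = tangent_scale (r s) (v s)"
  using c by (simp add: \<eta>_def tangent_of_linear tangent_of_w)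

lemma \<eta>_in: "s \<in> {0..1} \<Longrightarrow> \<eta> s \<in> Uc"
  using rv_in[of s] \<eta>_tangent[of s] tangent_of_self[OF c, of "\<eta> s"] unfolding Uc_def
  by (intro image_eqI[of _ _ "tangent_scale (r s) (v s)"]) auto

lemma \<alpha>_Phi: "s \<in> {0..1} \<Longrightarrow> \<alpha> s = Phi (\<eta> s)"
  by (simp add: \<alpha>_def Phi_def \<eta>_tangent)

lemma \<eta>_deriv: "s \<in> {0..1} \<Longrightarrow> has_curve_deriv \<eta> (\<eta>' s) s {0..1}"
  unfolding \<eta>_def[abs_def] \<eta>'_def by (intro has_curve_deriv_scaleR r_deriv w_deriv)

text \<open>\<alpha> is prescribed only on the unit interval, so it is compared with
  \<open>Phi (\<eta> s)\<close> through limits within that interval, one-sided at its ends.\<close>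

lemma velocity_\<alpha>:
  assumes s: "s \<in> {0..1}"
  shows "velocity A {0..1} \<alpha> s = dPhi (\<eta> s) (\<eta>' s)"
proof -
  obtain d where d: "d \<in> charts_at A (Phi (\<eta> s))" by (rule chart_exists)
  have dA: "d \<in> A" using d by (rule charts_atD)
  note sd = exp_domI[OF \<eta>_in[OF s] d]
  have eq: "\<forall>\<^sub>F t in at s within {0..1}. Phi (\<eta> t) = \<alpha> t"
    by (simp add: eventually_at_filter \<alpha>_Phi)
  have "velocity A {0..1} \<alpha> s = tangent_of A (\<alpha> s) d (dir_deriv (Phi_in d) (\<eta> s) (\<eta>' s))"
  proof (rule velocity_eq)
    have "((\<lambda>t. Phi (\<eta> t)) \<longlongrightarrow> Phi (\<eta> s)) (at s within {0..1})"
      by (intro Phi_tendsto has_curve_deriv_tendsto[OF \<eta>_deriv[OF s]] \<eta>_in s)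
    then show "(\<alpha> \<longlongrightarrow> \<alpha> s) (at s within {0..1})"
      unfolding \<alpha>_Phi[OF s] using eq by (rule Lim_transform_eventually)
    show "has_curve_deriv (snd d \<circ> \<alpha>) (dir_deriv (Phi_in d) (\<eta> s) (\<eta>' s)) s {0..1}"
    proof (rule has_curve_deriv_cong[OF Phi_in_curve[OF dA sd \<eta>_deriv[OF s]]])
      show "\<forall>\<^sub>F t in at s within {0..1}. Phi_in d (\<eta> t) = (snd d \<circ> \<alpha>) t"
        using eq by eventually_elim (simp add: Phi_in_def)
    qed (simp add: Phi_in_def \<alpha>_Phi[OF s])
  qed (use d at_within_unit[OF s] \<alpha>_Phi[OF s] in auto)
  then show ?thesis by (simp add: dPhi_eq[OF sd dA] \<alpha>_Phi[OF s])
qed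

lemma path_length_speed: "path_length A \<gamma> \<alpha> = integral {0..1} speed"
  unfolding path_length_def
  by (rule integral_cong) (simp add: gnorm_def speed_def velocity_\<alpha> \<alpha>_Phi)

lemma \<eta>'_tendsto:
  assumes s: "s \<in> {0..1}"
  shows "(\<eta>' \<longlongrightarrow> \<eta>' s) (at s within {0..1})"
proof -
  have "(r' \<longlongrightarrow> r' s) (at s within {0..1})" "(w' \<longlongrightarrow> w' s) (at s within {0..1})"
    using r'_cont w'_cont s by (auto simp: continuous_on_def)
  moreover have "(w \<longlongrightarrow> w s) (at s within {0..1})"
    by (rule has_curve_deriv_tendsto[OF w_deriv[OF s]])
  moreover have "(r \<longlongrightarrow> r s) (at s within {0..1})"
    using has_curve_deriv_tendsto[of r] r_deriv[OF s] by (simp add: has_curve_deriv_real)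
  ultimately show ?thesis
    unfolding \<eta>'_def[abs_def] by (intro tendsto_add_frechet tendsto_scaleR_frechet)
qed

lemma speed_cont: "continuous_on {0..1} speed"
  unfolding continuous_on_def
proof
  fix s :: real assume s: "s \<in> {0..1}"
  obtain d where d: "d \<in> charts_at A (Phi (\<eta> s))" by (rule chart_exists)
  have dA: "d \<in> A" using d by (rule charts_atD)
  note sd = exp_domI[OF \<eta>_in[OF s] d]
  note lim = has_curve_deriv_tendsto[OF \<eta>_deriv[OF s]]
  let ?D = "\<lambda>t. dir_deriv (Phi_in d) (\<eta> t) (\<eta>' t)"
  have eq: "speed t = sqrt (G d (Phi_in d (\<eta> t)) (?D t) (?D t))" if "\<eta> t \<in> exp_dom d" for t
    by (simp add: speed_def dPhi_metric[OF that dA])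
  have D: "(?D \<longlongrightarrow> ?D s) (at s within {0..1})"
    by (rule Ck_on_deriv_tendsto[OF Phi_Ck[OF dA] lim sd \<eta>'_tendsto[OF s]])
  have "((\<lambda>t. sqrt (G d (Phi_in d (\<eta> t)) (?D t) (?D t))) \<longlongrightarrow>
      sqrt (G d (Phi_in d (\<eta> s)) (?D s) (?D s))) (at s within {0..1})"
    by (intro tendsto_real_sqrt G_tendsto[OF dA exp_domD(2)[OF sd]] D
        Ck_on_tendsto[OF Phi_Ck[OF dA] lim sd])
  moreover have "\<forall>\<^sub>F t in at s within {0..1}. \<eta> t \<in> exp_dom d"
    using lim open_exp_dom[OF dA] sd by (rule topological_tendstoD)
  then have "\<forall>\<^sub>F t in at s within {0..1}. sqrt (G d (Phi_in d (\<eta> t)) (?D t) (?D t)) = speed t"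
    by eventually_elim (simp add: eq)
  ultimately show "(speed \<longlongrightarrow> speed s) (at s within {0..1})"
    unfolding eq[OF sd] by (rule Lim_transform_eventually)
qed

text \<open>
  By the Gauss lemma the image of the radial direction is a unit vector orthogonal to the image
  of \<open>w'\<close>.
\<close>

lemma speed_polar:
  assumes s: "s \<in> {0..1}" and pos: "r s > 0"
  obtains N where "speed s = sqrt ((r' s)\<^sup>2 + (r s)\<^sup>2 * N)" "N \<ge> 0" "N = 0 \<longleftrightarrow> w' s = 0"
proof -
  obtain d where d: "d \<in> charts_at A (Phi (\<eta> s))" by (rule chart_exists)
  have dA: "d \<in> A" using d by (rule charts_atD)
  note sd = exp_domI[OF \<eta>_in[OF s] d]
  note im = dA exp_domD(2)[OF sd]
  let ?D = "dir_deriv (Phi_in d) (\<eta> s)" and ?G = "G d (Phi_in d (\<eta> s))"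
  define N where "N = ?G (?D (w' s)) (?D (w' s))"
  \<comment> \<open>The Gauss lemma concerns the direction
    \<open>\<eta> s = r s *\<^sub>R w s\<close>; the factor \<open>r s\<close> can be cancelled
    because it is positive.\<close>
  have gauss: "?G (?D (w s)) (?D z) = g0 (w s) z" for z
  proof -
    have "?G (?D (\<eta> s)) (?D z) = g0 (\<eta> s) z"
      using gauss_lemma_radial[OF \<eta>_in[OF s], of z] by (simp add: dPhi_metric[OF sd dA])
    moreover have "?G (?D (\<eta> s)) (?D z) = r s * ?G (?D (w s)) (?D z)"
      using Phi_in_linear(2)[OF sd dA, of "r s" "w s"] G_scale_left[OF im] by (simp add: \<eta>_def)
    ultimately show ?thesis using pos G_scale_left[OF c_in] by (simp add: \<eta>_def)
  qed
  have sym: "?G (?D (w' s)) (?D (w s)) = ?G (?D (w s)) (?D (w' s))" by (rule G_sym[OF im])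
  have "?G (?D (\<eta>' s)) (?D (\<eta>' s)) = (r' s)\<^sup>2 * g0 (w s) (w s) + 2 * r s * r' s * g0 (w s) (w' s)
      + (r s)\<^sup>2 * N"
    unfolding \<eta>'_def Phi_in_linear[OF sd dA] G_add_left[OF im] G_add_right[OF im]
      G_scale_left[OF im] G_scale_right[OF im] sym gauss N_def[symmetric]
    by (simp add: power2_eq_square algebra_simps)
  then have "speed s = sqrt ((r' s)\<^sup>2 + (r s)\<^sup>2 * N)"
    by (simp add: speed_def dPhi_metric[OF sd dA] g0_w[OF s] g0_w_w'[OF s])
  moreover have "N \<ge> 0" unfolding N_def by (rule G_nonneg[OF im])
  moreover have "N = 0 \<longleftrightarrow> w' s = 0"
  proof
    assume "N = 0"
    then have "?D (w' s) = 0" using G_pos[OF im, of "?D (w' s)"] by (auto simp: N_def)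
    then have "dPhi (\<eta> s) (w' s) = tangent_zero"
      using exp_domD(3)[OF dA sd] by (simp add: dPhi_eq[OF sd dA] tangent_of_zero)
    then show "w' s = 0" by (rule dPhi_injective[OF \<eta>_in[OF s]])
  next
    assume "w' s = 0"
    then have "?D (w' s) = 0" using Phi_in_linear(2)[OF sd dA, of 0 0] by simp
    then show "N = 0" using G_zero[OF im] by (simp add: N_def)
  qed
  ultimately show ?thesis by (rule that)
qed

text \<open>Since \<open>r\<close> is nonnegative, an interior zero is a local minimum. At an end
  point \<open>r'\<close> may be nonzero, whence the open interval.\<close>

lemma at_center:
  assumes s: "s \<in> {0<..<1}" and r: "r s = 0"
  shows "r' s = 0" "speed s = 0"
proof -
  have s': "s \<in> {0..1}" using s by auto
  have "DERIV r s :> r' s"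
    using r_deriv[OF s'] s at_within_interior[of s "{0..1}"] by simp
  moreover have "\<forall>y. \<bar>s - y\<bar> < min s (1 - s) \<longrightarrow> r s \<le> r y"
  proof (intro allI impI)
    fix y assume "\<bar>s - y\<bar> < min s (1 - s)"
    then have "y \<in> {0..1}" by (simp add: abs_less_iff)
    then show "r s \<le> r y" using r r_nonneg by simp
  qed
  moreover have "0 < min s (1 - s)" using s by simp
  ultimately show r': "r' s = 0" by (metis DERIV_local_min)
  obtain d where d: "d \<in> charts_at A (Phi (\<eta> s))" by (rule chart_exists)
  have dA: "d \<in> A" using d by (rule charts_atD)
  note sd = exp_domI[OF \<eta>_in[OF s'] d]
  have "\<eta>' s = 0" using r r' by (simp add: \<eta>'_def)
  then show "speed s = 0"
    using Phi_in_linear(2)[OF sd dA, of 0 0] G_zero[OF dA exp_domD(2)[OF sd]]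
    by (simp add: speed_def dPhi_metric[OF sd dA])
qed

lemma speed_ge:
  assumes "s \<in> {0..1}"
  shows "\<bar>r' s\<bar> \<le> speed s"
proof -
  have "0 \<le> speed t - \<bar>r' t\<bar>" if t: "t \<in> {0<..<1}" for t
  proof (cases "r t = 0")
    case True
    then show ?thesis using at_center[OF t] by simp
  next
    case False
    have t': "t \<in> {0..1}" using t by auto
    then have "r t > 0" using False r_nonneg[OF t'] by simp
    then obtain N where N: "speed t = sqrt ((r' t)\<^sup>2 + (r t)\<^sup>2 * N)" "N \<ge> 0" "N = 0 \<longleftrightarrow> w' t = 0"
      by (rule speed_polar[OF t'])
    have "\<bar>r' t\<bar> = sqrt ((r' t)\<^sup>2)" by simp
    also have "\<dots> \<le> speed t" unfolding N(1) using N(2) by (intro real_sqrt_le_mono) simp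
    finally show ?thesis by simp
  qed
  moreover have "closure {0<..<1} = {0..1::real}" by simp
  moreover have "continuous_on {0..1} (\<lambda>s. speed s - \<bar>r' s\<bar>)"
    by (intro continuous_on_diff continuous_on_rabs speed_cont r'_cont)
  ultimately have "0 \<le> speed s - \<bar>r' s\<bar>"
    using continuous_ge_on_closure[of "{0<..<1}" "\<lambda>s. speed s - \<bar>r' s\<bar>" s 0] assms by simp
  then show ?thesis by simp
qed

text \<open>All three claims come from comparing the continuous speed with the derivatives of
  \<open>r\<close> and of \<open>- r\<close>, both of which it dominates.\<close>

lemma length_ge: "path_length A \<gamma> \<alpha> \<ge> \<bar>r 1 - r 0\<bar>"
  and length_eq_increasing: "path_length A \<gamma> \<alpha> = r 1 - r 0 \<longleftrightarrow> (\<forall>s\<in>{0..1}. speed s = r' s)"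
  and length_eq_decreasing: "path_length A \<gamma> \<alpha> = r 0 - r 1 \<longleftrightarrow> (\<forall>s\<in>{0..1}. speed s = - r' s)"
proof -
  have 1: "r' s \<le> speed s" "- r' s \<le> speed s" if "s \<in> {0..1}" for s
    using speed_ge[OF that] by auto
  have m: "((\<lambda>s. - r s) has_real_derivative - r' s) (at s within {0..1})" if "s \<in> {0..1}" for s
    using r_deriv[OF that] by (auto intro!: derivative_eq_intros)
  note inc = integral_ge_increment[OF zero_less_one r_deriv r'_cont speed_cont 1(1)]
  note dec = integral_ge_increment[OF zero_less_one m continuous_on_minus[OF r'_cont] speed_cont 1(2)]
  show "path_length A \<gamma> \<alpha> \<ge> \<bar>r 1 - r 0\<bar>"
    using inc(1) dec(1) by (simp add: path_length_speed)
  show "path_length A \<gamma> \<alpha> = r 1 - r 0 \<longleftrightarrow> (\<forall>s\<in>{0..1}. speed s = r' s)"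
    using inc(2) by (simp add: path_length_speed)
  show "path_length A \<gamma> \<alpha> = r 0 - r 1 \<longleftrightarrow> (\<forall>s\<in>{0..1}. speed s = - r' s)"
    using dec(2) by (simp add: path_length_speed)
qed

section \<open>The equality case\<close>

lemma speed_nonneg: "s \<in> {0..1} \<Longrightarrow> speed s \<ge> 0"
  using speed_ge[of s] by linarith

text \<open>A monotone radius has no zero between two points where it is positive. This is what
  allows \<open>w' = 0\<close> to be integrated from one such point to another.\<close>

lemma r_between_pos:
  assumes "(\<forall>s\<in>{0..1}. r' s \<ge> 0) \<or> (\<forall>s\<in>{0..1}. r' s \<le> 0)"
    and s: "s \<in> {a..b}" and ab: "a \<in> {0..1}" "b \<in> {0..1}" "r a > 0" "r b > 0"
  shows "r s > 0"
proof (cases "s = a \<or> s = b")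
  case True
  then show ?thesis using ab by auto
next
  case False
  then have strict: "a < s" "s < b" using s by auto
  have sub: "closed_segment p q \<subseteq> {0..1}" if "p \<in> {0..1}" "q \<in> {0..1}" for p q :: real
    using that by (intro closed_segment_subset) auto
  have s': "s \<in> {0..1}" using s ab by auto
  from assms(1) show ?thesis
  proof
    assume *: "\<forall>s\<in>{0..1}. r' s \<ge> 0"
    \<comment> \<open>The available mean value bound is an upper one, so the increasing case is run
      with \<open>- r\<close>.\<close>
    have "(- r s - - r a) / (s - a) \<le> 0"
    proof (rule difference_quotient_le)
      fix t assume "t \<in> closed_segment a s"
      then have t: "t \<in> {0..1}" using sub[OF ab(1) s'] by blast
      show "\<exists>m\<le>0. ((\<lambda>t. - r t) has_real_derivative m) (at t within closed_segment a s)"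
        using * t DERIV_subset[OF r_deriv[OF t] sub[OF ab(1) s']]
        by (intro exI[of _ "- r' t"]) (auto intro!: derivative_eq_intros)
    qed (use strict in auto)
    then show ?thesis using strict ab by (simp add: divide_le_0_iff)
  next
    assume *: "\<forall>s\<in>{0..1}. r' s \<le> 0"
    have "(r b - r s) / (b - s) \<le> 0"
    proof (rule difference_quotient_le)
      fix t assume "t \<in> closed_segment s b"
      then have t: "t \<in> {0..1}" using sub[OF s' ab(2)] by blast
      show "\<exists>m\<le>0. (r has_real_derivative m) (at t within closed_segment s b)"
        using * t DERIV_subset[OF r_deriv[OF t] sub[OF s' ab(2)]] by blast
    qed (use strict in auto)
    then show ?thesis using strict ab by (simp add: divide_le_0_iff)
  qed
qed

lemma w'_zero:
  assumes s: "s \<in> {0..1}" and "r s > 0" and eq: "speed s = \<bar>r' s\<bar>"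
  shows "w' s = 0"
proof -
  obtain N where N: "speed s = sqrt ((r' s)\<^sup>2 + (r s)\<^sup>2 * N)" "N \<ge> 0" "N = 0 \<longleftrightarrow> w' s = 0"
    by (rule speed_polar[OF s \<open>r s > 0\<close>])
  have "sqrt ((r' s)\<^sup>2 + (r s)\<^sup>2 * N) = sqrt ((r' s)\<^sup>2)" using N(1) eq by simp
  then have "(r s)\<^sup>2 * N = 0" unfolding real_sqrt_eq_iff by simp
  then show ?thesis using N(3) \<open>r s > 0\<close> by simp
qed

text \<open>The condition \<open>sgn\<close> excludes a stay at the center between two stretches
  with positive radius, during which the direction could turn without adding to the length.\<close>

lemma speed_eq_imp_constant:
  assumes eq: "\<And>s. s \<in> {0..1} \<Longrightarrow> speed s = \<bar>r' s\<bar>"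
    and sgn: "(\<forall>s\<in>{0..1}. r' s \<ge> 0) \<or> (\<forall>s\<in>{0..1}. r' s \<le> 0)"
  shows "\<exists>u. \<forall>s\<in>{0..1}. r s > 0 \<longrightarrow> v s = u"
proof -
  have le: "w b = w a" if ab: "a \<le> b" "a \<in> {0..1}" "b \<in> {0..1}" "r a > 0" "r b > 0" for a b
  proof (rule has_curve_deriv_zero_constant[OF \<open>a \<le> b\<close>])
    fix t assume t: "t \<in> {a..b}"
    have t': "t \<in> {0..1}" and sub: "{a..b} \<subseteq> {0..1}" using t ab by auto
    have "w' t = 0" using w'_zero[OF t' r_between_pos[OF sgn t] eq[OF t']] ab by blast
    then show "has_curve_deriv w 0 t {a..b}"
      using has_curve_deriv_subset[OF w_deriv[OF t'] sub] by simp
  qed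
  have "v a = v b" if "a \<in> {0..1}" "b \<in> {0..1}" "r a > 0" "r b > 0" for a b
    using le[of a b] le[of b a] that tangent_of_w by (metis linear)
  then show ?thesis by metis
qed

text \<open>Near an interior point with positive radius the radius stays positive, so
  \<open>w\<close> is locally constant and \<open>w' = 0\<close>. Interior zeros of \<open>r\<close>
  are covered by \<open>at_center\<close>, the end points by continuity.\<close>

lemma constant_imp_speed_eq:
  assumes const: "\<And>s. s \<in> {0..1} \<Longrightarrow> r s > 0 \<Longrightarrow> v s = u" and "s \<in> {0..1}"
  shows "speed s = \<bar>r' s\<bar>"
proof -
  have "speed t - \<bar>r' t\<bar> \<le> 0" if t: "t \<in> {0<..<1}" for t
  proof (cases "r t = 0")
    case True
    then show ?thesis using at_center[OF t] by simp
  next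
    case False
    have t': "t \<in> {0..1}" using t by auto
    then have pos: "r t > 0" using False r_nonneg[OF t'] by simp
    have "(r \<longlongrightarrow> r t) (at t within {0..1})"
      using has_curve_deriv_tendsto[of r] r_deriv[OF t'] by (simp add: has_curve_deriv_real)
    then have "\<forall>\<^sub>F s in at t within {0..1}. r s > 0" using pos by (rule order_tendstoD)
    then have "\<forall>\<^sub>F s in at t within {0..1}. w s = u c"
      unfolding eventually_at_filter by eventually_elim (simp add: w_def const)
    then have "has_curve_deriv (\<lambda>_. u c) (w' t) t {0..1}"
      by (rule has_curve_deriv_cong[OF w_deriv[OF t']]) (simp add: w_def const[OF t' pos])
    then have "w' t = 0"
      using has_curve_deriv_const at_within_unit[OF t'] by (rule has_curve_deriv_unique)
    moreover obtain N where "speed t = sqrt ((r' t)\<^sup>2 + (r t)\<^sup>2 * N)" "N \<ge> 0" "N = 0 \<longleftrightarrow> w' t = 0"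
      by (rule speed_polar[OF t' pos])
    ultimately show ?thesis by simp
  qed
  moreover have "closure {0<..<1} = {0..1::real}" by simp
  moreover have "continuous_on {0..1} (\<lambda>s. speed s - \<bar>r' s\<bar>)"
    by (intro continuous_on_diff continuous_on_rabs speed_cont r'_cont)
  ultimately have "speed s - \<bar>r' s\<bar> \<le> 0"
    using continuous_le_on_closure[of "{0<..<1}" "\<lambda>s. speed s - \<bar>r' s\<bar>" s 0] assms(2) by simp
  then show ?thesis using speed_ge[OF assms(2)] by simp
qed

text \<open>The absolute value equals one of the two increments, and each equality fixes the speed
  as \<open>r'\<close> or as \<open>- r'\<close> on the whole interval; nonnegativity of the speed
  then gives \<open>r'\<close> a constant sign.\<close>

lemma length_eq_iff:
  "path_length A \<gamma> \<alpha> = \<bar>r 1 - r 0\<bar> \<longleftrightarrow>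
    (\<exists>u. \<forall>s\<in>{0..1}. r s > 0 \<longrightarrow> v s = u) \<and>
    ((\<forall>s\<in>{0..1}. r' s \<ge> 0) \<or> (\<forall>s\<in>{0..1}. r' s \<le> 0))" (is "?L \<longleftrightarrow> ?R")
proof
  assume ?L
  then have "path_length A \<gamma> \<alpha> = r 1 - r 0 \<or> path_length A \<gamma> \<alpha> = r 0 - r 1" by linarith
  then have "(\<forall>s\<in>{0..1}. speed s = r' s) \<or> (\<forall>s\<in>{0..1}. speed s = - r' s)"
    by (simp only: length_eq_increasing length_eq_decreasing)
  then have sgn: "(\<forall>s\<in>{0..1}. r' s \<ge> 0) \<or> (\<forall>s\<in>{0..1}. r' s \<le> 0)"
    and eq: "\<And>s. s \<in> {0..1} \<Longrightarrow> speed s = \<bar>r' s\<bar>"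
    using speed_nonneg by fastforce+
  show ?R using speed_eq_imp_constant[OF eq sgn] sgn by blast
next
  assume ?R
  then obtain u where u: "\<And>s. s \<in> {0..1} \<Longrightarrow> r s > 0 \<Longrightarrow> v s = u"
    and sgn: "(\<forall>s\<in>{0..1}. r' s \<ge> 0) \<or> (\<forall>s\<in>{0..1}. r' s \<le> 0)" by blast
  from sgn have "(\<forall>s\<in>{0..1}. speed s = r' s) \<or> (\<forall>s\<in>{0..1}. speed s = - r' s)"
    using constant_imp_speed_eq[OF u] by auto
  then have "path_length A \<gamma> \<alpha> = r 1 - r 0 \<or> path_length A \<gamma> \<alpha> = r 0 - r 1"
    by (simp only: length_eq_increasing length_eq_decreasing)
  then show ?L using length_ge by linarith
qed

text \<open>The condition \<open>r 0 \<le> r 1\<close> selects the increasing alternative, and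
  density extends the constancy of \<open>v\<close> across the zeros of \<open>r\<close> by
  continuity.\<close>

lemma length_eq_iff_dense:
  assumes "r 0 \<le> r 1" and dense: "{0..1} \<subseteq> closure {s \<in> {0..1}. r s > 0}"
  shows "path_length A \<gamma> \<alpha> = \<bar>r 1 - r 0\<bar> \<longleftrightarrow>
    (\<exists>u. \<forall>s\<in>{0..1}. v s = u) \<and> (\<forall>s\<in>{0..1}. r' s \<ge> 0)" (is "?L \<longleftrightarrow> ?R")
proof
  assume L: ?L
  then have "\<forall>s\<in>{0..1}. speed s = r' s" using assms(1) by (simp add: length_eq_increasing)
  then have "\<forall>s\<in>{0..1}. r' s \<ge> 0" using speed_nonneg by force
  moreover obtain u where u: "\<And>s. s \<in> {0..1} \<Longrightarrow> r s > 0 \<Longrightarrow> v s = u"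
    using L length_eq_iff by blast
  \<comment> \<open>Continuity is available for the chart component \<open>w\<close>; its constant
    value is carried back to a tangent vector at \<open>x\<close> by
    \<open>tangent_of\<close>.\<close>
  have "v s = tangent_of A x c (u c)" if s: "s \<in> {0..1}" for s
  proof -
    have "closure {s \<in> {0..1}. r s > 0} \<subseteq> {0..1}" by (rule closure_minimal) auto
    moreover have "continuous_on {0..1} w"
      unfolding continuous_on_def using w_deriv has_curve_deriv_tendsto by blast
    ultimately have "continuous_on (closure {s \<in> {0..1}. r s > 0}) w"
      by (rule continuous_on_subset[rotated])
    then have "w s = u c"
      by (rule continuous_constant_on_closure) (use u dense s in \<open>auto simp: w_def\<close>)
    then show ?thesis using tangent_of_w[OF s] by simp
  qed
  ultimately show ?R by blast
next
  assume ?R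
  then show ?L using length_eq_iff by blast
qed

end

theorem proposition7:
  fixes A :: "('n::t2_space, 'e::frechet_space) chart set"
    and \<gamma> :: "('n, 'e) metric_tensor"
    and x :: 'n
    and U :: "('n, 'e) tangent set"
    and V :: "'n set"
    and r r' :: "real \<Rightarrow> real"
    and v :: "real \<Rightarrow> ('n, 'e) tangent"
    and \<alpha> :: "real \<Rightarrow> 'n"
  assumes "weak_riemannian_manifold A \<gamma>"
    and "normalizable_on A \<gamma> x U V"
    and "\<forall>s\<in>{0..1}. (r has_real_derivative r' s) (at s within {0..1})"
    and "continuous_on {0..1} r'"
    and "C1_tangent_path A x v"
    and "\<forall>s\<in>{0..1}. r s \<ge> 0"
    and "\<forall>s\<in>{0..1}. v s \<in> unit_sphere A \<gamma> x"
    and "\<forall>s\<in>{0..1}. tangent_scale (r s) (v s) \<in> U"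
    and "\<forall>s\<in>{0..1}. \<alpha> s = riem_exp A \<gamma> x (tangent_scale (r s) (v s))"
  shows "path_length A \<gamma> \<alpha> \<ge> \<bar>r 1 - r 0\<bar> \<and>
    (path_length A \<gamma> \<alpha> = \<bar>r 1 - r 0\<bar> \<longleftrightarrow>
       (\<exists>w. \<forall>s\<in>{0..1}. r s > 0 \<longrightarrow> v s = w) \<and>
       ((\<forall>s\<in>{0..1}. r' s \<ge> 0) \<or> (\<forall>s\<in>{0..1}. r' s \<le> 0))) \<and>
    (r 0 \<le> r 1 \<and> {0..1} \<subseteq> closure {s \<in> {0..1}. r s > 0} \<longrightarrow>
       (path_length A \<gamma> \<alpha> = \<bar>r 1 - r 0\<bar> \<longleftrightarrow>
          (\<exists>w. \<forall>s\<in>{0..1}. v s = w) \<and> (\<forall>s\<in>{0..1}. r' s \<ge> 0)))"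
proof -
  have man: "smooth_manifold A" "riemannian_metric A \<gamma>"
    using assms(1) by (auto simp: weak_riemannian_manifold_def smooth_manifold_def)
  obtain c where "c \<in> charts_at A x" by (rule smooth_manifold.chart_exists[OF man(1)])
  then interpret polar_path A \<gamma> x U V c r r' v \<alpha>
    using assms man
    by (auto simp: polar_path_def polar_path_axioms_def normal_neighborhood_def
        normal_neighborhood_axioms_def riemannian_manifold_def riemannian_manifold_axioms_def)
  show ?thesis using length_ge length_eq_iff length_eq_iff_dense by blast
qed

end
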